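(* Let $R\in O(\mathbb R^D)$ be an orthogonal transformation such that the measure satisfies $d\mu(x)=d\mu(Rx)$. Then: (1) the orthogonal polynomials satisfy $P(Rx)=\eta_RP(x)$; (2) for every $n\in\mathbb R^D$ the Jacobi matrices satisfy $(Rn)\cdot J=\eta_R\,(n\cdot J)\,\eta_R^{-1}$; (3) the Christoffel–Darboux kernels are invariant: $K^{(\ell)}(Rx,Ry)=K^{(\ell)}(x,y)$ for all $\ell$.
   Context: Let $D\ge 1$ and let $\mu$ be a Borel measure on $\mathbb R^D$ with finite moments. Invariance $d\mu(x)=d\mu(Rx)$ means $\mu(R^{-1}(A))=\mu(A)$ for all measurable $A$. For $k\in\mathbb Z_+$ let $[k]=\{\alpha\in\mathbb Z_+^D:|\alpha|=k\}$, ordered so that $\alpha>\alpha'$ iff at the first coordinate where they differ the entry of $\alpha$ is smaller. $\chi_{[k]}(x)$ is the column vector of monomials $x^\alpha$, $\alpha\in[k]$, and $\chi$ stacks $\chi_{[0]},\chi_{[1]},\dots$. Semi-infinite matrices are partitioned in blocks $A_{[k],[\ell]}\in\mathbb R^{|[k]|\times|[\ell]|}$; $A^{[\ell]}$ is the truncation to the first $\ell$ block rows and columns. The moment matrix is $G=\int\chi\,d\mu\,\chi^\top$. Standing assumption: $\det G^{[\ell]}\ne0$ for all $\ell$, so that $G=S^{-1}H(S^{-1})^\top$ with $S$ block lower triangular with identity diagonal blocks and $H=\operatorname{diag}(H_{[0]},H_{[1]},\dots)$. The orthogonal polynomials are $P=S\chi$; $K^{(\ell)}(x,y)=\sum_{k=0}^{\ell-1}P_{[k]}(x)^\top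 H_{[k]}^{-1}P_{[k]}(y)$. Shift matrices: $\Lambda_a$ has as only nonzero blocks $(\Lambda_a)_{[k],[k+1]}$, with entries $\delta_{\alpha+e_a,\alpha'}$, $\alpha\in[k]$, $\alpha'\in[k+1]$. Jacobi matrices: $J_a=S\Lambda_aS^{-1}$, $n\cdot J=\sum_an_aJ_a$. $\eta_R=\operatorname{diag}(\eta_{R,[0]},\eta_{R,[1]},\dots)$ is the block diagonal matrix with $\eta_{R,[k]}=\mathcal M_{[k]}^{-1}[R^{\odot k}]_{B_c}\mathcal M_{[k]}$, where $[R^{\odot k}]_{B_c}$ is the matrix of the $k$-th symmetric power of $R$ acting on the symmetric tensor power $(\mathbb R^D)^{\odot k}$ in the basis $B_c$ consisting of $e^{\alpha}=e_1^{\odot\alpha_1}\odot\cdots\odot e_D^{\odot\alpha_D}$, $\alpha\in[k]$ (listed increasingly in the order on $[k]$ for which $\alpha>\alpha'$ iff at the first coordinate where they differ the entry of $\alpha$ is smaller), and $\mathcal M_{[k]}$ is the diagonal matrix of multinomial coefficients $\binom{k}{\alpha}=k!/\prod_a\alpha_a!$, $\alpha\in[k]$. Equivalently, $\chi_{[k]}(Rx)=\eta_{R,[k]}\chi_{[k]}(x)$ for all $x$. *)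

theory Defs
  imports
    "HOL-Analysis.Analysis"
    "HOL-Library.Groups_Big_Fun"
    "HOL-Combinatorics.Permutations"
    "Jordan_Normal_Form.Determinant"
begin

(* Euclidean D-space is real ^ 'd. The linear order on 'd is the order of the coordinates. *)

type_synonym 'd mindex = "'d \<Rightarrow> nat"

definition mdeg :: "'d::finite mindex \<Rightarrow> nat" where
  "mdeg \<alpha> = (\<Sum>a\<in>UNIV. \<alpha> a)"

definition mlevel :: "nat \<Rightarrow> 'd::finite mindex set" where
  "mlevel k = {\<alpha>. mdeg \<alpha> = k}"

definition mless :: "'d::linorder mindex \<Rightarrow> 'd mindex \<Rightarrow> bool" where
  "mless \<alpha>' \<alpha> \<longleftrightarrow> (\<exists>a. (\<forall>b<a. \<alpha> b = \<alpha>' b) \<and> \<alpha> a < \<alpha>' a)"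

definition mlist :: "nat \<Rightarrow> 'd::{finite,linorder} mindex list" where
  "mlist k = (THE xs. sorted_wrt mless xs \<and> set xs = mlevel k)"

definition chi :: "real ^ 'd::finite \<Rightarrow> 'd mindex \<Rightarrow> real" where
  "chi x \<alpha> = (\<Prod>a\<in>UNIV. vec_nth x a ^ \<alpha> a)"


(* Semi-infinite matrices and vectors have their entries labelled by the multi-indices
   themselves. The (k,l) block consists of the entries with row label in mlevel k and column
   label in mlevel l. A product is given by finitely supported sums: Sum_any is the sum over the
   support of the summand if that is finite. All products below are of this kind. *)

type_synonym 'd smat = "'d mindex \<Rightarrow> 'd mindex \<Rightarrow> real"

definition smat_mult :: "'d smat \<Rightarrow> 'd smat \<Rightarrow> 'd smat" (infixl "**\<^sub>s" 70) where
  "A **\<^sub>s B = (\<lambda>\<alpha> \<gamma>. Sum_any (\<lambda>\<beta>. A \<alpha> \<beta> * B \<beta> \<gamma>))"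

definition smat_mult_vec :: "'d smat \<Rightarrow> ('d mindex \<Rightarrow> real) \<Rightarrow> 'd mindex \<Rightarrow> real" (infixl "*v\<^sub>s" 70) where
  "A *v\<^sub>s v = (\<lambda>\<alpha>. Sum_any (\<lambda>\<beta>. A \<alpha> \<beta> * v \<beta>))"

definition stranspose :: "'d smat \<Rightarrow> 'd smat" where
  "stranspose A = (\<lambda>\<alpha> \<beta>. A \<beta> \<alpha>)"

definition sone_on :: "'d mindex set \<Rightarrow> 'd smat" where
  "sone_on I = (\<lambda>\<alpha> \<beta>. if \<alpha> = \<beta> \<and> \<alpha> \<in> I then 1 else 0)"

definition sblock :: "nat \<Rightarrow> nat \<Rightarrow> 'd::finite smat \<Rightarrow> 'd smat" where
  "sblock k l A = (\<lambda>\<alpha> \<beta>. if \<alpha> \<in> mlevel k \<and> \<beta> \<in> mlevel l then A \<alpha> \<beta> else 0)"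

(* Two-sided inverse of an I x I matrix (extended by 0): I = UNIV gives the inverse of a
   semi-infinite matrix, I = mlevel k the inverse of a diagonal block. *)
definition sinv_on :: "'d mindex set \<Rightarrow> 'd smat \<Rightarrow> 'd smat" where
  "sinv_on I A = (THE B. (\<forall>\<alpha> \<beta>. B \<alpha> \<beta> \<noteq> 0 \<longrightarrow> \<alpha> \<in> I \<and> \<beta> \<in> I)
                       \<and> A **\<^sub>s B = sone_on I \<and> B **\<^sub>s A = sone_on I)"

abbreviation sinv :: "'d smat \<Rightarrow> 'd smat" where
  "sinv \<equiv> sinv_on UNIV"

definition block_diagonal :: "'d::finite smat \<Rightarrow> bool" where
  "block_diagonal A \<longleftrightarrow> (\<forall>k l. k \<noteq> l \<longrightarrow> sblock k l A = (\<lambda>_ _. 0))"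

definition block_lower_unitriangular :: "'d::finite smat \<Rightarrow> bool" where
  "block_lower_unitriangular A \<longleftrightarrow>
     (\<forall>k l. k < l \<longrightarrow> sblock k l A = (\<lambda>_ _. 0)) \<and> (\<forall>k. sblock k k A = sone_on (mlevel k))"

definition strunc :: "nat \<Rightarrow> 'd::{finite,linorder} smat \<Rightarrow> real mat" where
  "strunc l A = (let xs = concat (map mlist [0..<l])
                 in mat (length xs) (length xs) (\<lambda>(i, j). A (xs ! i) (xs ! j)))"


definition finite_moments :: "(real ^ 'd::finite) measure \<Rightarrow> bool" where
  "finite_moments \<mu> \<longleftrightarrow> (\<forall>\<alpha>. integrable \<mu> (\<lambda>x. chi x \<alpha>))"

definition moment_matrix :: "(real ^ 'd::finite) measure \<Rightarrow> 'd smat" where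
  "moment_matrix \<mu> = (\<lambda>\<alpha> \<beta>. integral\<^sup>L \<mu> (\<lambda>x. chi x \<alpha> * chi x \<beta>))"

definition gauss_borel :: "'d::finite smat \<Rightarrow> 'd smat \<Rightarrow> 'd smat \<Rightarrow> bool" where
  "gauss_borel G S H \<longleftrightarrow> block_lower_unitriangular S \<and> block_diagonal H
     \<and> G = sinv S **\<^sub>s H **\<^sub>s stranspose (sinv S)"

(* S and H exist and are unique if all the truncations of the moment matrix are invertible. *)
definition gb_S :: "(real ^ 'd::finite) measure \<Rightarrow> 'd smat" where
  "gb_S \<mu> = (THE S. \<exists>H. gauss_borel (moment_matrix \<mu>) S H)"

definition gb_H :: "(real ^ 'd::finite) measure \<Rightarrow> 'd smat" where
  "gb_H \<mu> = (THE H. gauss_borel (moment_matrix \<mu>) (gb_S \<mu>) H)"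

definition orth_poly :: "(real ^ 'd::finite) measure \<Rightarrow> real ^ 'd \<Rightarrow> 'd mindex \<Rightarrow> real" where
  "orth_poly \<mu> x = gb_S \<mu> *v\<^sub>s chi x"

definition CD_kernel :: "(real ^ 'd::finite) measure \<Rightarrow> nat \<Rightarrow> real ^ 'd \<Rightarrow> real ^ 'd \<Rightarrow> real" where
  "CD_kernel \<mu> l x y = (\<Sum>k<l. \<Sum>\<alpha>\<in>mlevel k. \<Sum>\<beta>\<in>mlevel k.
     orth_poly \<mu> x \<alpha> * sinv_on (mlevel k) (sblock k k (gb_H \<mu>)) \<alpha> \<beta> * orth_poly \<mu> y \<beta>)"

definition shift :: "'d \<Rightarrow> 'd smat" where
  "shift a = (\<lambda>\<alpha> \<alpha>'. if \<alpha>' = \<alpha>(a := \<alpha> a + 1) then 1 else 0)"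

definition jacobi :: "(real ^ 'd::finite) measure \<Rightarrow> 'd \<Rightarrow> 'd smat" where
  "jacobi \<mu> a = gb_S \<mu> **\<^sub>s shift a **\<^sub>s sinv (gb_S \<mu>)"

definition dot_jacobi :: "(real ^ 'd::finite) measure \<Rightarrow> real ^ 'd \<Rightarrow> 'd smat" where
  "dot_jacobi \<mu> n = (\<lambda>\<alpha> \<beta>. \<Sum>a\<in>UNIV. vec_nth n a * jacobi \<mu> a \<alpha> \<beta>)"


(* An order k tensor over real ^ 'd is its array of components, indexed by the lists in 'd of
   length k (and 0 at all other lists). The symmetric tensor power is the space of symmetric
   tensors, with the symmetrised tensor product. *)

type_synonym 'd tensor = "'d list \<Rightarrow> real"

definition tensor_prod :: "(real ^ 'd) list \<Rightarrow> 'd tensor" where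
  "tensor_prod vs = (\<lambda>is. if length is = length vs
                           then \<Prod>j<length vs. vec_nth (vs ! j) (is ! j) else 0)"

definition sym_prod :: "(real ^ 'd) list \<Rightarrow> 'd tensor" where
  "sym_prod vs = (\<lambda>is. (\<Sum>\<sigma> | \<sigma> permutes {..<length vs}. tensor_prod (permute_list \<sigma> vs) is)
                        / fact (length vs))"

definition sym_basis :: "'d::{finite,linorder} mindex \<Rightarrow> 'd tensor" where
  "sym_basis \<alpha> =
     sym_prod (concat (map (\<lambda>a. replicate (\<alpha> a) (axis a 1)) (sorted_list_of_set UNIV)))"

(* The k-th tensor power of R; its restriction to symmetric tensors is the k-th symmetric power,
   mapping sym_prod [v1,...,vk] to sym_prod [R v1,...,R vk]. *)
definition tensor_power :: "real ^ 'd::{finite,linorder} ^ 'd::{finite,linorder} \<Rightarrow> nat \<Rightarrow> 'd tensor \<Rightarrow> 'd tensor" where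
  "tensor_power R k T = (\<lambda>is. if length is = k
     then \<Sum>js | length js = k. (\<Prod>m<k. vec_nth (vec_nth R (is ! m)) (js ! m)) * T js else 0)"

(* Matrix of the k-th symmetric power of R in the basis sym_basis (mlevel k): column \<beta> holds the
   coordinates of the image of sym_basis \<beta>. *)
definition sym_power_matrix :: "real ^ 'd::{finite,linorder} ^ 'd::{finite,linorder} \<Rightarrow> nat \<Rightarrow> 'd::{finite,linorder} smat" where
  "sym_power_matrix R k = (THE M.
     (\<forall>\<alpha> \<beta>. M \<alpha> \<beta> \<noteq> 0 \<longrightarrow> \<alpha> \<in> mlevel k \<and> \<beta> \<in> mlevel k) \<and>
     (\<forall>\<beta>\<in>mlevel k. tensor_power R k (sym_basis \<beta>) =
                    (\<lambda>is. \<Sum>\<alpha>\<in>mlevel k. M \<alpha> \<beta> * sym_basis \<alpha> is)))"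

definition multinomial :: "'d::finite mindex \<Rightarrow> real" where
  "multinomial \<alpha> = fact (mdeg \<alpha>) / (\<Prod>a\<in>UNIV. fact (\<alpha> a))"

definition multinomial_matrix :: "nat \<Rightarrow> 'd::finite smat" where
  "multinomial_matrix k = (\<lambda>\<alpha> \<beta>. if \<alpha> = \<beta> \<and> \<alpha> \<in> mlevel k then multinomial \<alpha> else 0)"

definition eta_block :: "real ^ 'd::{finite,linorder} ^ 'd::{finite,linorder} \<Rightarrow> nat \<Rightarrow> 'd::{finite,linorder} smat" where
  "eta_block R k = sinv_on (mlevel k) (multinomial_matrix k)
                     **\<^sub>s sym_power_matrix R k **\<^sub>s multinomial_matrix k"

definition eta :: "real ^ 'd::{finite,linorder} ^ 'd::{finite,linorder} \<Rightarrow> 'd::{finite,linorder} smat" where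
  "eta R = (\<lambda>\<alpha> \<beta>. if mdeg \<alpha> = mdeg \<beta> then eta_block R (mdeg \<alpha>) \<alpha> \<beta> else 0)"

end

theory Submission
  imports Defs "HOL-Combinatorics.Multiset_Permutations"
begin

text \<open>Row \<open>\<alpha>\<close> of \<open>S\<close> is the unique polynomial with leading part \<open>x\<^sup>\<alpha>\<close> that is orthogonal to all
  monomials of degree below \<open>|\<alpha>|\<close>. Since \<open>\<chi>(Rx) = \<eta> \<chi>(x)\<close>, invariance of the measure says that
  \<open>G = \<eta> G \<eta>\<^sup>T\<close>; as \<open>\<eta>\<close> is block diagonal, \<open>\<eta> S \<eta>\<^sup>-\<^sup>1\<close> has the same defining property, so \<open>\<eta>\<close>
  commutes with \<open>S\<close> and \<open>\<eta> H \<eta>\<^sup>T = H\<close>. This gives (1) and (3). For (2) it remains to see that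
  \<open>\<eta> (n \<cdot> \<Lambda>) = (Rn \<cdot> \<Lambda>) \<eta>\<close>; applied to \<open>\<chi>(x)\<close> both sides are \<open>(n \<cdot> x) \<chi>(Rx)\<close>, and monomials are
  linearly independent.\<close>

section \<open>Index sets\<close>

text \<open>The main obstacle is that products of semi-infinite matrices are not associative for
  free: \<open>Sum_any\<close> is 0 on an infinite support, and the moment matrix is full. Every
  regrouping around it rests on finite rows on its left or finite columns on its right, which block
  triangular and block diagonal matrices supply. A second obstacle is that \<open>gb_S\<close>,
  \<open>gb_H\<close>, the inverses and the matrix of the symmetric power are definite descriptions,
  so each one needs existence and uniqueness. For S both come from the invertible truncations: the
  entries of row \<alpha> in degrees below k = |\<alpha>| solve a linear system whose matrix is the
  truncation of G to k block rows and columns. Finally, \<chi>(Rx) = \<eta> \<chi>(x) is not how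
  \<eta> is defined. It is derived by reading tensor components as words in the coordinates: the
  multinomial coefficient counts the words with given letter counts, and conjugation by these
  numbers turns coordinates in the symmetrised basis into coefficients of monomials.\<close>

lemma finite_mdeg_le: "finite {\<alpha> :: 'd::finite mindex. mdeg \<alpha> \<le> n}"
proof -
  have "{\<alpha> :: 'd mindex. mdeg \<alpha> \<le> n} \<subseteq> (UNIV \<rightarrow>\<^sub>E {..n})"
  proof
    fix \<alpha> :: "'d mindex" assume "\<alpha> \<in> {\<alpha>. mdeg \<alpha> \<le> n}"
    then have "\<alpha> a \<le> n" for a
      using member_le_sum[of a UNIV \<alpha>] by (auto simp: mdeg_def)
    then show "\<alpha> \<in> UNIV \<rightarrow>\<^sub>E {..n}" by auto
  qed
  then show ?thesis by (rule finite_subset) (auto intro: finite_PiE)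
qed

lemma finite_mlevel: "finite (mlevel k)"
  by (rule finite_subset[OF _ finite_mdeg_le[of k]]) (auto simp: mlevel_def)

lemma finite_mdeg_less: "finite {\<alpha> :: 'd::finite mindex. mdeg \<alpha> < n}"
  by (rule finite_subset[OF _ finite_mdeg_le[of n]]) auto

text \<open>\<open>mlist\<close> is described as the list sorted by \<open>mless\<close> with a
  given set of entries. As \<open>mless\<close> is a linear order, the sorted lists of the library
  provide its existence and uniqueness.\<close>

lemma mless_linorder:
  "class.linorder (\<lambda>\<alpha> \<beta> :: 'd::{finite,linorder} mindex. \<alpha> = \<beta> \<or> mless \<alpha> \<beta>) mless"
proof -
  have irrefl: "\<not> mless \<alpha> \<alpha>" for \<alpha> :: "'d mindex"
    by (simp add: mless_def)
  have trans: "mless \<alpha> \<gamma>" if ab: "mless \<alpha> \<beta>" and bc: "mless \<beta> \<gamma>" for \<alpha> \<beta> \<gamma> :: "'d mindex"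
  proof -
    obtain a where a: "\<And>c. c < a \<Longrightarrow> \<beta> c = \<alpha> c" "\<beta> a < \<alpha> a" using ab unfolding mless_def by auto
    obtain b where b: "\<And>c. c < b \<Longrightarrow> \<gamma> c = \<beta> c" "\<gamma> b < \<beta> b" using bc unfolding mless_def by auto
    have "\<gamma> c = \<alpha> c" if "c < min a b" for c
      using a(1) b(1) that by simp
    moreover have "\<gamma> (min a b) < \<alpha> (min a b)"
      by (cases a b rule: linorder_cases) (use a b in auto)
    ultimately show ?thesis unfolding mless_def by blast
  qed
  have total: "mless \<alpha> \<beta> \<or> mless \<beta> \<alpha>" if "\<alpha> \<noteq> \<beta>" for \<alpha> \<beta> :: "'d mindex"
  proof -
    define a where "a = Min {a. \<alpha> a \<noteq> \<beta> a}"
    have ne: "{a. \<alpha> a \<noteq> \<beta> a} \<noteq> {}" using that by auto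
    have "\<alpha> a \<noteq> \<beta> a"
      using Min_in[OF _ ne] by (simp add: a_def)
    moreover have "\<alpha> b = \<beta> b" if "b < a" for b
    proof (rule ccontr)
      assume "\<alpha> b \<noteq> \<beta> b"
      then have "a \<le> b" by (simp add: a_def)
      with that show False by simp
    qed
    ultimately show ?thesis
      by (cases "\<alpha> a" "\<beta> a" rule: linorder_cases) (auto simp: mless_def intro!: exI[of _ a])
  qed
  show ?thesis
  proof
    fix \<alpha> \<beta> \<gamma> :: "'d mindex"
    show "mless \<alpha> \<beta> \<longleftrightarrow> (\<alpha> = \<beta> \<or> mless \<alpha> \<beta>) \<and> \<not> (\<beta> = \<alpha> \<or> mless \<beta> \<alpha>)"
      using irrefl trans by metis
    show "\<alpha> = \<alpha> \<or> mless \<alpha> \<alpha>" by simp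
    show "\<alpha> = \<gamma> \<or> mless \<alpha> \<gamma>" if "\<alpha> = \<beta> \<or> mless \<alpha> \<beta>" "\<beta> = \<gamma> \<or> mless \<beta> \<gamma>"
      using that trans by metis
    show "\<alpha> = \<beta>" if "\<alpha> = \<beta> \<or> mless \<alpha> \<beta>" "\<beta> = \<alpha> \<or> mless \<beta> \<alpha>"
      using that irrefl trans by metis
    show "(\<alpha> = \<beta> \<or> mless \<alpha> \<beta>) \<or> \<beta> = \<alpha> \<or> mless \<beta> \<alpha>"
      using total by metis
  qed
qed

lemma mlist:
  "sorted_wrt mless (mlist k :: 'd::{finite,linorder} mindex list)" (is ?A)
  "set (mlist k :: 'd mindex list) = mlevel k" (is ?B)
proof -
  interpret ml: linorder "\<lambda>\<alpha> \<beta> :: 'd mindex. \<alpha> = \<beta> \<or> mless \<alpha> \<beta>" mless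
    by (rule mless_linorder)
  have "\<exists>!xs :: 'd mindex list. sorted_wrt mless xs \<and> set xs = mlevel k"
    using ml.strict_sorted_list_of_set[of "mlevel k"] ml.set_sorted_list_of_set[OF finite_mlevel, of k]
      ml.strict_sorted_equal by (metis (no_types, lifting))
  then have "sorted_wrt mless (mlist k :: 'd mindex list) \<and> set (mlist k :: 'd mindex list) = mlevel k"
    unfolding mlist_def by (rule theI')
  then show ?A ?B by auto
qed

lemma distinct_mlist: "distinct (mlist k :: 'd::{finite,linorder} mindex list)"
proof -
  interpret ml: linorder "\<lambda>\<alpha> \<beta> :: 'd mindex. \<alpha> = \<beta> \<or> mless \<alpha> \<beta>" mless
    by (rule mless_linorder)
  show ?thesis using ml.strict_sorted_iff mlist(1) by blast
qed

lemma mlists_below: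
  defines "xs \<equiv> \<lambda>l. concat (map mlist [0..<l]) :: 'd::{finite,linorder} mindex list"
  shows "distinct (xs l)" "set (xs l) = {\<alpha>. mdeg \<alpha> < l}"
proof -
  show S: "set (xs l) = {\<alpha>. mdeg \<alpha> < l}" for l
    by (auto simp: xs_def mlist mlevel_def)
  show "distinct (xs l)"
  proof (induction l)
    case (Suc l)
    have "xs (Suc l) = xs l @ mlist l" by (simp add: xs_def)
    with Suc S[of l] distinct_mlist[of l] mlist(2)[of l] show ?case
      by (auto simp: mlevel_def)
  qed (simp add: xs_def)
qed

text \<open>This moves the determinant hypothesis from numbered rows and columns to multi-indices.
  All later arguments sum over \<open>{\<gamma>. mdeg \<gamma> < l}\<close>, where the enumeration
  by \<open>mlist\<close> no longer matters.\<close>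

lemma strunc_inverse:
  fixes G :: "'d::{finite,linorder} smat"
  assumes "Determinant.det (strunc l G) \<noteq> 0"
  obtains C :: "'d smat" where
    "\<And>\<alpha> \<beta>. mdeg \<alpha> < l \<Longrightarrow> mdeg \<beta> < l \<Longrightarrow>
       (\<Sum>\<gamma> | mdeg \<gamma> < l. G \<alpha> \<gamma> * C \<gamma> \<beta>) = (if \<alpha> = \<beta> then 1 else 0)"
    "\<And>\<alpha> \<beta>. mdeg \<alpha> < l \<Longrightarrow> mdeg \<beta> < l \<Longrightarrow>
       (\<Sum>\<gamma> | mdeg \<gamma> < l. C \<alpha> \<gamma> * G \<gamma> \<beta>) = (if \<alpha> = \<beta> then 1 else 0)"
proof -
  define xs where "xs = (concat (map mlist [0..<l]) :: 'd mindex list)"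
  define n where "n = length xs"
  define A where "A = strunc l G"
  have A: "A = mat n n (\<lambda>(i, j). G (xs ! i) (xs ! j))"
    by (simp add: A_def strunc_def xs_def n_def Let_def)
  have cA: "A \<in> carrier_mat n n" by (simp add: A)
  have dist: "distinct xs" and set: "set xs = {\<alpha>. mdeg \<alpha> < l}"
    using mlists_below[of l] by (simp_all add: xs_def)
  have bij: "bij_betw ((!) xs) {0..<n} {\<alpha>. mdeg \<alpha> < l}"
    using bij_betw_nth[OF dist, of "{0..<n}"] set by (simp add: n_def lessThan_atLeast0)
  obtain B where B: "B \<in> carrier_mat n n" "A * B = 1\<^sub>m n" "B * A = 1\<^sub>m n"
    using det_non_zero_imp_unit[OF cA assms[folded A_def], of undefined]
    by (auto simp: Units_def ring_mat_def)
  define ix where "ix = the_inv_into {0..<n} ((!) xs)"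
  have ix: "ix (xs ! i) = i" if "i < n" for i
    using that bij by (simp add: ix_def the_inv_into_f_f bij_betw_def)
  define C where "C = (\<lambda>\<alpha> \<beta>. B $$ (ix \<alpha>, ix \<beta>))"
  have ex: "\<exists>i<n. \<alpha> = xs ! i" if "mdeg \<alpha> < l" for \<alpha>
    using that set by (metis in_set_conv_nth mem_Collect_eq n_def)
  have sum: "(\<Sum>\<gamma> | mdeg \<gamma> < l. f \<gamma>) = (\<Sum>j\<in>{0..<n}. f (xs ! j))" for f :: "'d mindex \<Rightarrow> real"
    using sum.reindex_bij_betw[OF bij, of f] by simp
  show thesis
  proof
    fix \<alpha> \<beta> :: "'d mindex" assume "mdeg \<alpha> < l" "mdeg \<beta> < l"
    then obtain i j where ij: "i < n" "j < n" "\<alpha> = xs ! i" "\<beta> = xs ! j" using ex by metis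
    have eq: "xs ! i = xs ! j \<longleftrightarrow> i = j"
      using dist ij(1,2) by (simp add: n_def nth_eq_iff_index_eq)
    have "(A * B) $$ (i, j) = (\<Sum>m\<in>{0..<n}. A $$ (i, m) * B $$ (m, j))"
      using cA B(1) ij by (simp add: scalar_prod_def)
    also have "\<dots> = (\<Sum>\<gamma> | mdeg \<gamma> < l. G \<alpha> \<gamma> * C \<gamma> \<beta>)"
      unfolding sum by (rule sum.cong) (use ij in \<open>simp_all add: A C_def ix\<close>)
    finally show "(\<Sum>\<gamma> | mdeg \<gamma> < l. G \<alpha> \<gamma> * C \<gamma> \<beta>) = (if \<alpha> = \<beta> then 1 else 0)"
      using B(2) ij eq by simp
    have "(B * A) $$ (i, j) = (\<Sum>m\<in>{0..<n}. B $$ (i, m) * A $$ (m, j))"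
      using cA B(1) ij by (simp add: scalar_prod_def)
    also have "\<dots> = (\<Sum>\<gamma> | mdeg \<gamma> < l. C \<alpha> \<gamma> * G \<gamma> \<beta>)"
      unfolding sum by (rule sum.cong) (use ij in \<open>simp_all add: A C_def ix\<close>)
    finally show "(\<Sum>\<gamma> | mdeg \<gamma> < l. C \<alpha> \<gamma> * G \<gamma> \<beta>) = (if \<alpha> = \<beta> then 1 else 0)"
      using B(3) ij eq by simp
  qed
qed

section \<open>Semi-infinite matrices\<close>

text \<open>The finiteness that makes \<open>Sum_any\<close> an honest sum whatever the other factor
  is, as is required for products with the full matrix G.\<close>

definition row_finite :: "'d smat \<Rightarrow> bool" where
  "row_finite A \<longleftrightarrow> (\<forall>\<alpha>. finite {\<beta>. A \<alpha> \<beta> \<noteq> 0})"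

abbreviation col_finite :: "'d smat \<Rightarrow> bool" where
  "col_finite A \<equiv> row_finite (stranspose A)"

lemma smat_mult_sum:
  assumes "finite F" "\<And>\<beta>. \<beta> \<notin> F \<Longrightarrow> A \<alpha> \<beta> * B \<beta> \<gamma> = 0"
  shows "(A **\<^sub>s B) \<alpha> \<gamma> = (\<Sum>\<beta>\<in>F. A \<alpha> \<beta> * B \<beta> \<gamma>)"
  unfolding smat_mult_def using assms by (intro Sum_any.expand_superset) auto

lemma smat_mult_nonzero:
  assumes "(A **\<^sub>s B) \<alpha> \<gamma> \<noteq> 0"
  obtains \<beta> where "A \<alpha> \<beta> \<noteq> 0" "B \<beta> \<gamma> \<noteq> 0"
proof -
  have "\<exists>\<beta>. A \<alpha> \<beta> * B \<beta> \<gamma> \<noteq> 0"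
    using assms unfolding smat_mult_def by (meson Sum_any.not_neutral_obtains_not_neutral)
  with that show thesis by auto
qed

lemma stranspose_stranspose [simp]: "stranspose (stranspose A) = A"
  by (simp add: stranspose_def)

lemma stranspose_mult: "stranspose (A **\<^sub>s B) = stranspose B **\<^sub>s stranspose A"
  by (simp add: stranspose_def smat_mult_def mult.commute)

lemma stranspose_sone_on [simp]: "stranspose (sone_on I) = sone_on I"
  by (intro ext) (auto simp: stranspose_def sone_on_def)

lemma row_finite_mult:
  assumes "row_finite A" "row_finite B"
  shows "row_finite (A **\<^sub>s B)"
  unfolding row_finite_def
proof
  fix \<alpha>
  have "{\<gamma>. (A **\<^sub>s B) \<alpha> \<gamma> \<noteq> 0} \<subseteq> (\<Union>\<beta>\<in>{\<beta>. A \<alpha> \<beta> \<noteq> 0}. {\<gamma>. B \<beta> \<gamma> \<noteq> 0})"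
    by (auto elim: smat_mult_nonzero)
  then show "finite {\<gamma>. (A **\<^sub>s B) \<alpha> \<gamma> \<noteq> 0}"
    by (rule finite_subset) (use assms in \<open>auto simp: row_finite_def\<close>)
qed

text \<open>Associativity at a single entry, as an exchange of two finite sums. The condition on
  \<open>F'\<close> concerns the product of the entries of \<open>B\<close> and \<open>C\<close>, so
  that it covers both finite rows of \<open>B\<close> and a finite column of
  \<open>C\<close>.\<close>

lemma smat_mult_assoc_finite:
  assumes fin: "finite F" "finite F'"
    and F: "\<And>\<beta>. \<beta> \<notin> F \<Longrightarrow> A \<alpha> \<beta> = 0"
    and F': "\<And>\<beta> \<gamma>. \<beta> \<in> F \<Longrightarrow> \<gamma> \<notin> F' \<Longrightarrow> B \<beta> \<gamma> * C \<gamma> \<delta> = 0"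
  shows "((A **\<^sub>s B) **\<^sub>s C) \<alpha> \<delta> = (A **\<^sub>s (B **\<^sub>s C)) \<alpha> \<delta>"
proof -
  have AB: "(A **\<^sub>s B) \<alpha> \<gamma> = (\<Sum>\<beta>\<in>F. A \<alpha> \<beta> * B \<beta> \<gamma>)" for \<gamma>
    by (rule smat_mult_sum) (use fin F in auto)
  have BC: "(B **\<^sub>s C) \<beta> \<delta> = (\<Sum>\<gamma>\<in>F'. B \<beta> \<gamma> * C \<gamma> \<delta>)" if "\<beta> \<in> F" for \<beta>
    by (rule smat_mult_sum) (use fin F' that in auto)
  have "((A **\<^sub>s B) **\<^sub>s C) \<alpha> \<delta> = (\<Sum>\<gamma>\<in>F'. (A **\<^sub>s B) \<alpha> \<gamma> * C \<gamma> \<delta>)"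
  proof (rule smat_mult_sum[OF fin(2)])
    fix \<gamma> assume "\<gamma> \<notin> F'"
    then have "(\<Sum>\<beta>\<in>F. A \<alpha> \<beta> * (B \<beta> \<gamma> * C \<gamma> \<delta>)) = 0" using F' by (intro sum.neutral) simp
    then show "(A **\<^sub>s B) \<alpha> \<gamma> * C \<gamma> \<delta> = 0" by (simp add: AB sum_distrib_right mult.assoc)
  qed
  also have "\<dots> = (\<Sum>\<beta>\<in>F. A \<alpha> \<beta> * (\<Sum>\<gamma>\<in>F'. B \<beta> \<gamma> * C \<gamma> \<delta>))"
    unfolding AB sum_distrib_left sum_distrib_right by (subst sum.swap) (simp add: mult.assoc)
  also have "\<dots> = (A **\<^sub>s (B **\<^sub>s C)) \<alpha> \<delta>"
    using BC by (subst smat_mult_sum[OF fin(1)]) (simp_all add: F)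
  finally show ?thesis .
qed

text \<open>The suffixes of the three laws tell which two factors have finite rows (r) or finite
  columns (c). The remaining factor is arbitrary: G may stand last in rr, in the middle in rc and
  first in cc.\<close>

lemma smat_mult_assoc_rr:
  assumes "row_finite A" "row_finite B"
  shows "(A **\<^sub>s B) **\<^sub>s C = A **\<^sub>s (B **\<^sub>s C)"
proof (intro ext)
  fix \<alpha> \<delta>
  show "((A **\<^sub>s B) **\<^sub>s C) \<alpha> \<delta> = (A **\<^sub>s (B **\<^sub>s C)) \<alpha> \<delta>"
    by (rule smat_mult_assoc_finite[of "{\<beta>. A \<alpha> \<beta> \<noteq> 0}" "\<Union>\<beta>\<in>{\<beta>. A \<alpha> \<beta> \<noteq> 0}. {\<gamma>. B \<beta> \<gamma> \<noteq> 0}"])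
       (use assms in \<open>auto simp: row_finite_def\<close>)
qed

lemma smat_mult_assoc_rc:
  assumes "row_finite A" "col_finite C"
  shows "(A **\<^sub>s B) **\<^sub>s C = A **\<^sub>s (B **\<^sub>s C)"
proof (intro ext)
  fix \<alpha> \<delta>
  show "((A **\<^sub>s B) **\<^sub>s C) \<alpha> \<delta> = (A **\<^sub>s (B **\<^sub>s C)) \<alpha> \<delta>"
    by (rule smat_mult_assoc_finite[of "{\<beta>. A \<alpha> \<beta> \<noteq> 0}" "{\<gamma>. C \<gamma> \<delta> \<noteq> 0}"])
       (use assms in \<open>auto simp: row_finite_def stranspose_def\<close>)
qed

lemma smat_mult_assoc_cc:
  assumes "col_finite B" "col_finite C"
  shows "(A **\<^sub>s B) **\<^sub>s C = A **\<^sub>s (B **\<^sub>s C)"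
proof -
  have "stranspose ((A **\<^sub>s B) **\<^sub>s C) = stranspose (A **\<^sub>s (B **\<^sub>s C))"
    using smat_mult_assoc_rr[OF assms(2,1)] by (simp add: stranspose_mult)
  then show ?thesis by (metis stranspose_stranspose)
qed

text \<open>A vector is treated as a matrix with constant rows, so that facts about matrix products
  carry over.\<close>

lemma smat_mult_vec_eq: "(A *v\<^sub>s v) \<alpha> = (A **\<^sub>s (\<lambda>\<beta> _. v \<beta>)) \<alpha> \<gamma>"
  by (simp add: smat_mult_vec_def smat_mult_def)

lemma smat_mult_vec_assoc:
  assumes "row_finite A" "row_finite B"
  shows "(A **\<^sub>s B) *v\<^sub>s v = A *v\<^sub>s (B *v\<^sub>s v)"
proof
  fix \<alpha>
  have "((A **\<^sub>s B) *v\<^sub>s v) \<alpha> = (A **\<^sub>s (B **\<^sub>s (\<lambda>\<beta> _. v \<beta>))) \<alpha> \<alpha>"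
    by (subst smat_mult_vec_eq[where \<gamma> = \<alpha>]) (simp add: smat_mult_assoc_rr assms)
  also have "\<dots> = (A *v\<^sub>s (B *v\<^sub>s v)) \<alpha>"
    by (simp add: smat_mult_def smat_mult_vec_def)
  finally show "((A **\<^sub>s B) *v\<^sub>s v) \<alpha> = (A *v\<^sub>s (B *v\<^sub>s v)) \<alpha>" .
qed

lemma sone_on_mult: "(sone_on I **\<^sub>s A) \<alpha> \<beta> = (if \<alpha> \<in> I then A \<alpha> \<beta> else 0)"
  by (subst smat_mult_sum[of "{\<alpha>}"]) (auto simp: sone_on_def)

lemma mult_sone_on: "(A **\<^sub>s sone_on I) \<alpha> \<beta> = (if \<beta> \<in> I then A \<alpha> \<beta> else 0)"
  by (subst smat_mult_sum[of "{\<beta>}"]) (auto simp: sone_on_def)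

lemma sone_mult [simp]: "sone_on UNIV **\<^sub>s A = A"
  by (simp add: sone_on_mult fun_eq_iff)

lemma mult_sone [simp]: "A **\<^sub>s sone_on UNIV = A"
  by (simp add: mult_sone_on fun_eq_iff)

lemma sone_mult_vec [simp]: "sone_on UNIV *v\<^sub>s v = v"
  using smat_mult_vec_eq[of "sone_on UNIV" v] by (simp add: fun_eq_iff)

lemma row_finite_sone_on: "row_finite (sone_on I)"
  unfolding row_finite_def sone_on_def
  by (intro allI, rule finite_subset[of _ "{_}"]) auto

text \<open>Uniqueness is the usual B' = (B A) B' = B (A B') = B. The competitor B' may be any
  matrix, so the associativity has to come from finite rows of \<open>A\<close> and
  \<open>B\<close>.\<close>

lemma sinv_on_eqI:
  assumes rf: "row_finite A" "row_finite B"
    and sup: "\<And>\<alpha> \<beta>. B \<alpha> \<beta> \<noteq> 0 \<Longrightarrow> \<alpha> \<in> I \<and> \<beta> \<in> I"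
    and AB: "A **\<^sub>s B = sone_on I" and BA: "B **\<^sub>s A = sone_on I"
  shows "sinv_on I A = B"
  unfolding sinv_on_def
proof (rule the_equality)
  show "(\<forall>\<alpha> \<beta>. B \<alpha> \<beta> \<noteq> 0 \<longrightarrow> \<alpha> \<in> I \<and> \<beta> \<in> I) \<and> A **\<^sub>s B = sone_on I \<and> B **\<^sub>s A = sone_on I"
    using assms by blast
  fix B' assume B': "(\<forall>\<alpha> \<beta>. B' \<alpha> \<beta> \<noteq> 0 \<longrightarrow> \<alpha> \<in> I \<and> \<beta> \<in> I)
      \<and> A **\<^sub>s B' = sone_on I \<and> B' **\<^sub>s A = sone_on I"
  have "B' = sone_on I **\<^sub>s B'" using B' by (auto simp: sone_on_mult fun_eq_iff)
  also have "\<dots> = B **\<^sub>s sone_on I"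
    using B' smat_mult_assoc_rr[OF rf(2,1), of B'] BA by simp
  also have "\<dots> = B" using sup by (auto simp: mult_sone_on fun_eq_iff)
  finally show "B' = B" .
qed

lemma sinv_eqI:
  assumes "row_finite A" "row_finite B" "A **\<^sub>s B = sone_on UNIV" "B **\<^sub>s A = sone_on UNIV"
  shows "sinv A = B"
  using assms by (intro sinv_on_eqI) auto

section \<open>Block diagonal and block lower unitriangular matrices, entrywise\<close>

lemma block_diagonal_iff: "block_diagonal A \<longleftrightarrow> (\<forall>\<alpha> \<beta>. mdeg \<alpha> \<noteq> mdeg \<beta> \<longrightarrow> A \<alpha> \<beta> = 0)"
  unfolding block_diagonal_def sblock_def mlevel_def fun_eq_iff by auto

lemma block_lower_unitriangular_iff:
  "block_lower_unitriangular A \<longleftrightarrow>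
     (\<forall>\<alpha> \<beta>. mdeg \<alpha> \<le> mdeg \<beta> \<longrightarrow> A \<alpha> \<beta> = (if \<alpha> = \<beta> then 1 else 0))"
  (is "?L \<longleftrightarrow> ?R")
proof
  assume L: ?L
  show ?R
  proof (intro allI impI)
    fix \<alpha> \<beta> :: "'a mindex" assume le: "mdeg \<alpha> \<le> mdeg \<beta>"
    show "A \<alpha> \<beta> = (if \<alpha> = \<beta> then 1 else 0)"
    proof (cases "mdeg \<alpha> = mdeg \<beta>")
      case True
      have "sblock (mdeg \<alpha>) (mdeg \<alpha>) A \<alpha> \<beta> = sone_on (mlevel (mdeg \<alpha>)) \<alpha> \<beta>"
        using L by (simp add: block_lower_unitriangular_def)
      with True show ?thesis by (simp add: sblock_def sone_on_def mlevel_def)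
    next
      case False
      then have "sblock (mdeg \<alpha>) (mdeg \<beta>) A \<alpha> \<beta> = 0"
        using L le by (simp add: block_lower_unitriangular_def)
      with False show ?thesis by (auto simp: sblock_def mlevel_def)
    qed
  qed
next
  assume ?R
  then show ?L
    by (auto simp: block_lower_unitriangular_def sblock_def sone_on_def mlevel_def intro!: ext)
qed

lemma block_lower_unitriangular_zero:
  "block_lower_unitriangular A \<Longrightarrow> mdeg \<alpha> < mdeg \<beta> \<Longrightarrow> A \<alpha> \<beta> = 0"
  by (auto simp: block_lower_unitriangular_iff)

lemma row_finite_if_lower:
  assumes "\<And>\<alpha> \<beta>. mdeg \<alpha> < mdeg \<beta> \<Longrightarrow> A \<alpha> \<beta> = 0"
  shows "row_finite A"
  unfolding row_finite_def
proof
  fix \<alpha>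
  show "finite {\<beta>. A \<alpha> \<beta> \<noteq> 0}"
    by (rule finite_subset[OF _ finite_mdeg_le[of "mdeg \<alpha>"]]) (use assms not_le in blast)
qed

lemma row_finite_block_diagonal: "block_diagonal A \<Longrightarrow> row_finite A"
  by (rule row_finite_if_lower) (auto simp: block_diagonal_iff)

lemma block_diagonal_stranspose: "block_diagonal A \<Longrightarrow> block_diagonal (stranspose A)"
  by (auto simp: block_diagonal_iff stranspose_def)

lemma col_finite_block_diagonal: "block_diagonal A \<Longrightarrow> col_finite A"
  by (intro row_finite_block_diagonal block_diagonal_stranspose)

lemma row_finite_block_lower_unitriangular: "block_lower_unitriangular A \<Longrightarrow> row_finite A"
  by (rule row_finite_if_lower) (auto simp: block_lower_unitriangular_iff)

lemma block_lower_unitriangular_right_inverse: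
  assumes S: "block_lower_unitriangular S"
  obtains T where "block_lower_unitriangular T" "S **\<^sub>s T = sone_on UNIV"
proof -
  \<comment> \<open>Forward substitution, by recursion on the degree of the row index: row \<alpha>
    of S T = 1 expresses row \<alpha> of T by rows of smaller degree, because the diagonal blocks of
    S are identities.\<close>
  define T where "T = wfrec (Wellfounded.measure mdeg) (\<lambda>T \<alpha> \<beta>. (if \<alpha> = \<beta> then 1 else 0) -
     (\<Sum>\<gamma> | mdeg \<gamma> < mdeg \<alpha>. S \<alpha> \<gamma> * T \<gamma> \<beta>))"
  have T: "T \<alpha> \<beta> = (if \<alpha> = \<beta> then 1 else 0) - (\<Sum>\<gamma> | mdeg \<gamma> < mdeg \<alpha>. S \<alpha> \<gamma> * T \<gamma> \<beta>)" for \<alpha> \<beta>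
    unfolding T_def by (subst wfrec) (auto simp: cut_def intro!: sum.cong)
  have "mdeg \<alpha> \<le> mdeg \<beta> \<longrightarrow> T \<alpha> \<beta> = (if \<alpha> = \<beta> then 1 else 0)" for \<alpha> \<beta>
  proof (induction "mdeg \<alpha>" arbitrary: \<alpha> rule: less_induct)
    case less
    have "S \<alpha> \<gamma> * T \<gamma> \<beta> = 0" if "mdeg \<gamma> < mdeg \<alpha>" "mdeg \<alpha> \<le> mdeg \<beta>" for \<gamma>
      using less[OF that(1)] that by auto
    then show ?case by (subst T) (auto intro!: sum.neutral)
  qed
  then have T_low: "block_lower_unitriangular T" by (simp add: block_lower_unitriangular_iff)
  have "(S **\<^sub>s T) \<alpha> \<beta> = (if \<alpha> = \<beta> then 1 else 0)" for \<alpha> \<beta>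
  proof -
    have "(S **\<^sub>s T) \<alpha> \<beta> = (\<Sum>\<gamma>\<in>insert \<alpha> {\<gamma>. mdeg \<gamma> < mdeg \<alpha>}. S \<alpha> \<gamma> * T \<gamma> \<beta>)"
      by (rule smat_mult_sum) (use S finite_mdeg_less in \<open>auto simp: block_lower_unitriangular_iff not_less\<close>)
    also have "\<dots> = S \<alpha> \<alpha> * T \<alpha> \<beta> + (\<Sum>\<gamma> | mdeg \<gamma> < mdeg \<alpha>. S \<alpha> \<gamma> * T \<gamma> \<beta>)"
      by (rule sum.insert) (use finite_mdeg_less in auto)
    also have "\<dots> = (if \<alpha> = \<beta> then 1 else 0)"
      using S T[of \<alpha> \<beta>] by (simp add: block_lower_unitriangular_iff)
    finally show ?thesis .
  qed
  then have "S **\<^sub>s T = sone_on UNIV" by (simp add: sone_on_def fun_eq_iff)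
  with T_low that show thesis by blast
qed

text \<open>A right inverse T of S has itself a right inverse U. Then S = S (T U) = (S T) U = U, so
  T is a two-sided inverse.\<close>

lemma sinv_block_lower_unitriangular:
  assumes S: "block_lower_unitriangular S"
  shows "block_lower_unitriangular (sinv S)"
    and "S **\<^sub>s sinv S = sone_on UNIV" and "sinv S **\<^sub>s S = sone_on UNIV"
proof -
  obtain T where T: "block_lower_unitriangular T" "S **\<^sub>s T = sone_on UNIV"
    using block_lower_unitriangular_right_inverse[OF S] by blast
  obtain U where U: "block_lower_unitriangular U" "T **\<^sub>s U = sone_on UNIV"
    using block_lower_unitriangular_right_inverse[OF T(1)] by blast
  note rf = row_finite_block_lower_unitriangular
  have "S = (S **\<^sub>s T) **\<^sub>s U" using smat_mult_assoc_rr[OF rf[OF S] rf[OF T(1)], of U] U(2) by simp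
  then have TS: "T **\<^sub>s S = sone_on UNIV" using T(2) U(2) by simp
  have "sinv S = T" by (rule sinv_eqI) (use rf S T TS in auto)
  with T TS show "block_lower_unitriangular (sinv S)"
    and "S **\<^sub>s sinv S = sone_on UNIV" and "sinv S **\<^sub>s S = sone_on UNIV" by auto
qed

section \<open>The Gauss--Borel factorization\<close>

text \<open>\<open>C l\<close> inverts the truncation of G to degrees below l. Its entries outside
  that range are left open.\<close>

definition trunc_inverse :: "'d::finite smat \<Rightarrow> (nat \<Rightarrow> 'd smat) \<Rightarrow> bool" where
  "trunc_inverse G C \<longleftrightarrow> (\<forall>l \<alpha> \<beta>. mdeg \<alpha> < l \<longrightarrow> mdeg \<beta> < l \<longrightarrow>
     (\<Sum>\<gamma> | mdeg \<gamma> < l. G \<alpha> \<gamma> * C l \<gamma> \<beta>) = (if \<alpha> = \<beta> then 1 else 0) \<and>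
     (\<Sum>\<gamma> | mdeg \<gamma> < l. C l \<alpha> \<gamma> * G \<gamma> \<beta>) = (if \<alpha> = \<beta> then 1 else 0))"

lemma trunc_inverse_exists:
  fixes G :: "'d::{finite,linorder} smat"
  assumes "\<And>l. Determinant.det (strunc l G) \<noteq> 0"
  obtains C where "trunc_inverse G C"
proof -
  have "\<forall>l. \<exists>C. \<forall>\<alpha> \<beta>. mdeg \<alpha> < l \<longrightarrow> mdeg \<beta> < l \<longrightarrow>
     (\<Sum>\<gamma> | mdeg \<gamma> < l. G \<alpha> \<gamma> * C \<gamma> \<beta>) = (if \<alpha> = \<beta> then 1 else 0) \<and>
     (\<Sum>\<gamma> | mdeg \<gamma> < l. C \<alpha> \<gamma> * G \<gamma> \<beta>) = (if \<alpha> = \<beta> then 1 else 0)"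
  proof
    fix l
    show "\<exists>C. \<forall>\<alpha> \<beta>. mdeg \<alpha> < l \<longrightarrow> mdeg \<beta> < l \<longrightarrow>
       (\<Sum>\<gamma> | mdeg \<gamma> < l. G \<alpha> \<gamma> * C \<gamma> \<beta>) = (if \<alpha> = \<beta> then 1 else 0) \<and>
       (\<Sum>\<gamma> | mdeg \<gamma> < l. C \<alpha> \<gamma> * G \<gamma> \<beta>) = (if \<alpha> = \<beta> then 1 else 0)"
      by (rule strunc_inverse[OF assms[of l]]) blast
  qed
  from choice[OF this] show thesis
    using that unfolding trunc_inverse_def by blast
qed

text \<open>For the moment matrix, the entry of S G at (\<alpha>, \<gamma>) is the integral of
  P_\<alpha>(x) x^\<gamma>. This characterises S without H or an inverse, which makes it easy to
  transport along \<eta>.\<close>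

definition monic_orthogonal :: "'d::finite smat \<Rightarrow> 'd smat \<Rightarrow> bool" where
  "monic_orthogonal G S \<longleftrightarrow> block_lower_unitriangular S
     \<and> (\<forall>\<alpha> \<gamma>. mdeg \<gamma> < mdeg \<alpha> \<longrightarrow> (S **\<^sub>s G) \<alpha> \<gamma> = 0)"

lemma lower_mult_sum:
  assumes "block_lower_unitriangular S" "mdeg \<alpha> < l"
  shows "(S **\<^sub>s G) \<alpha> \<gamma> = (\<Sum>\<beta> | mdeg \<beta> < l. S \<alpha> \<beta> * G \<beta> \<gamma>)"
  by (rule smat_mult_sum[OF finite_mdeg_less]) (use assms in \<open>auto simp: block_lower_unitriangular_iff\<close>)

lemma trunc_mult_cancel:
  fixes A B :: "'d::finite smat"
  assumes AB: "\<And>\<beta>. mdeg \<beta> < l \<Longrightarrow> (\<Sum>\<gamma> | mdeg \<gamma> < l. A \<beta> \<gamma> * B \<gamma> \<delta>) = (if \<beta> = \<delta> then 1 else 0)"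
    and \<delta>: "mdeg \<delta> < l"
  shows "(\<Sum>\<gamma> | mdeg \<gamma> < l. (\<Sum>\<beta> | mdeg \<beta> < l. v \<beta> * A \<beta> \<gamma>) * B \<gamma> \<delta>) = v \<delta>"
proof -
  have "(\<Sum>\<gamma> | mdeg \<gamma> < l. (\<Sum>\<beta> | mdeg \<beta> < l. v \<beta> * A \<beta> \<gamma>) * B \<gamma> \<delta>)
      = (\<Sum>\<beta> | mdeg \<beta> < l. v \<beta> * (\<Sum>\<gamma> | mdeg \<gamma> < l. A \<beta> \<gamma> * B \<gamma> \<delta>))"
    unfolding sum_distrib_right sum_distrib_left by (subst sum.swap) (simp add: mult.assoc)
  also have "\<dots> = (\<Sum>\<beta> | mdeg \<beta> < l. if \<beta> = \<delta> then v \<beta> else 0)"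
    by (rule sum.cong) (use AB in auto)
  also have "\<dots> = v \<delta>"
    using \<delta> by (simp add: sum.delta[OF finite_mdeg_less])
  finally show ?thesis .
qed

lemma trunc_inverse_right:
  assumes "trunc_inverse G C" "mdeg \<delta> < l"
  shows "(\<Sum>\<gamma> | mdeg \<gamma> < l. (\<Sum>\<beta> | mdeg \<beta> < l. v \<beta> * G \<beta> \<gamma>) * C l \<gamma> \<delta>) = v \<delta>"
  by (rule trunc_mult_cancel) (use assms in \<open>auto simp: trunc_inverse_def\<close>)

lemma trunc_inverse_left:
  assumes "trunc_inverse G C" "mdeg \<delta> < l"
  shows "(\<Sum>\<gamma> | mdeg \<gamma> < l. (\<Sum>\<beta> | mdeg \<beta> < l. v \<beta> * C l \<beta> \<gamma>) * G \<gamma> \<delta>) = v \<delta>"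
  by (rule trunc_mult_cancel) (use assms in \<open>auto simp: trunc_inverse_def\<close>)

text \<open>In row \<alpha> of the difference the leading parts cancel. What remains lives in
  degrees below |\<alpha>| and is annihilated by the truncation of G, which is invertible.\<close>

lemma monic_orthogonal_unique:
  assumes C: "trunc_inverse G C" and S: "monic_orthogonal G S" and S': "monic_orthogonal G S'"
  shows "S = (S' :: 'a::finite smat)"
proof (intro ext)
  fix \<alpha> \<delta> :: "'a mindex"
  define k where "k = mdeg \<alpha>"
  define D where "D = (\<lambda>\<beta>. S \<alpha> \<beta> - S' \<alpha> \<beta>)"
  have D_high: "D \<beta> = 0" if "k \<le> mdeg \<beta>" for \<beta>
    using that S S' by (simp add: D_def k_def monic_orthogonal_def block_lower_unitriangular_iff)
  have D_G: "(\<Sum>\<beta> | mdeg \<beta> < k. D \<beta> * G \<beta> \<gamma>) = 0" if "mdeg \<gamma> < k" for \<gamma>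
  proof -
    \<comment> \<open>Degree k is added to the range because the rows of S and S' reach degree k,
      although their difference vanishes there; now each summand is an entry of a full product with
      G.\<close>
    have "(\<Sum>\<beta> | mdeg \<beta> < k. D \<beta> * G \<beta> \<gamma>) = (\<Sum>\<beta> | mdeg \<beta> < Suc k. D \<beta> * G \<beta> \<gamma>)"
      by (rule sum.mono_neutral_left[OF finite_mdeg_less]) (auto simp: D_high)
    also have "\<dots> = (S **\<^sub>s G) \<alpha> \<gamma> - (S' **\<^sub>s G) \<alpha> \<gamma>"
      using S S' unfolding monic_orthogonal_def
      by (simp add: lower_mult_sum[where l = "Suc k"] k_def D_def left_diff_distrib sum_subtractf)
    also have "\<dots> = 0" using S S' that by (simp add: monic_orthogonal_def k_def)
    finally show ?thesis .
  qed
  have "D \<delta> = 0"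
  proof (cases "mdeg \<delta> < k")
    case True
    then show ?thesis using trunc_inverse_right[OF C True, of D] D_G by simp
  qed (simp add: D_high)
  then show "S \<alpha> \<delta> = S' \<alpha> \<delta>" by (simp add: D_def)
qed

lemma monic_orthogonal_exists:
  assumes C: "trunc_inverse G C"
  obtains S where "monic_orthogonal G S"
proof -
  \<comment> \<open>With k = |\<alpha>|, the part s of row \<alpha> below degree k must satisfy s G
    = - (row \<alpha> of G) on the columns of degree below k. Multiplication by \<open>C k\<close>
    from the right gives this formula.\<close>
  define S where "S = (\<lambda>\<alpha> \<beta>. if mdeg \<alpha> \<le> mdeg \<beta> then (if \<alpha> = \<beta> then 1 else 0)
     else - (\<Sum>\<gamma> | mdeg \<gamma> < mdeg \<alpha>. G \<alpha> \<gamma> * C (mdeg \<alpha>) \<gamma> \<beta>))"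
  have low: "block_lower_unitriangular S"
    by (simp add: block_lower_unitriangular_iff S_def)
  have "(S **\<^sub>s G) \<alpha> \<delta> = 0" if lt: "mdeg \<delta> < mdeg \<alpha>" for \<alpha> \<delta>
  proof -
    have "(S **\<^sub>s G) \<alpha> \<delta> = (\<Sum>\<beta>\<in>insert \<alpha> {\<beta>. mdeg \<beta> < mdeg \<alpha>}. S \<alpha> \<beta> * G \<beta> \<delta>)"
      by (rule smat_mult_sum) (auto simp: S_def finite_mdeg_less)
    also have "\<dots> = S \<alpha> \<alpha> * G \<alpha> \<delta> + (\<Sum>\<beta> | mdeg \<beta> < mdeg \<alpha>. S \<alpha> \<beta> * G \<beta> \<delta>)"
      by (rule sum.insert) (use finite_mdeg_less in auto)
    also have "(\<Sum>\<beta> | mdeg \<beta> < mdeg \<alpha>. S \<alpha> \<beta> * G \<beta> \<delta>)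
        = - (\<Sum>\<beta> | mdeg \<beta> < mdeg \<alpha>. (\<Sum>\<gamma> | mdeg \<gamma> < mdeg \<alpha>. G \<alpha> \<gamma> * C (mdeg \<alpha>) \<gamma> \<beta>) * G \<beta> \<delta>)"
      unfolding sum_negf[symmetric] by (rule sum.cong) (auto simp: S_def)
    also have "\<dots> = - G \<alpha> \<delta>"
      using trunc_inverse_left[OF C lt, of "G \<alpha>"] by simp
    finally show ?thesis by (simp add: S_def)
  qed
  with low have "monic_orthogonal G S" by (simp add: monic_orthogonal_def)
  then show thesis by (rule that)
qed

text \<open>Cancel the outer factors of the factorization, first by S on the left, then by its
  transpose on the right. The first identity displays S G as a block upper triangular matrix; the
  second shows that S determines H.\<close>

lemma gauss_borel_H:
  assumes "gauss_borel G S H"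
  shows "S **\<^sub>s G = H **\<^sub>s stranspose (sinv S)" "H = S **\<^sub>s G **\<^sub>s stranspose S"
proof -
  let ?T = "sinv S"
  have S: "block_lower_unitriangular S" and H: "block_diagonal H"
    and G: "G = ?T **\<^sub>s H **\<^sub>s stranspose ?T"
    using assms by (simp_all add: gauss_borel_def)
  note T = sinv_block_lower_unitriangular[OF S]
  have rf: "row_finite S" "row_finite ?T" "row_finite H"
    using S T(1) H by (auto intro: row_finite_block_lower_unitriangular row_finite_block_diagonal)
  have "S **\<^sub>s G = (S **\<^sub>s (?T **\<^sub>s H)) **\<^sub>s stranspose ?T"
    unfolding G by (rule smat_mult_assoc_rr[symmetric]) (intro rf row_finite_mult)+
  also have "S **\<^sub>s (?T **\<^sub>s H) = H"
    using smat_mult_assoc_rr[OF rf(1,2), of H] T(2) by simp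
  finally show SG: "S **\<^sub>s G = H **\<^sub>s stranspose ?T" .
  have "H **\<^sub>s stranspose ?T **\<^sub>s stranspose S = H **\<^sub>s (stranspose ?T **\<^sub>s stranspose S)"
    by (rule smat_mult_assoc_cc) (simp_all add: rf)
  also have "\<dots> = H"
    using T(2) by (simp flip: stranspose_mult)
  finally show "H = S **\<^sub>s G **\<^sub>s stranspose S" by (simp add: SG)
qed

lemma gauss_borel_monic_orthogonal:
  assumes "gauss_borel G S H"
  shows "monic_orthogonal G S"
proof -
  have S: "block_lower_unitriangular S" and H: "block_diagonal H"
    using assms by (simp_all add: gauss_borel_def)
  have "mdeg \<alpha> \<le> mdeg \<gamma>" if "(S **\<^sub>s G) \<alpha> \<gamma> \<noteq> 0" for \<alpha> \<gamma>
  proof -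
    have "(H **\<^sub>s stranspose (sinv S)) \<alpha> \<gamma> \<noteq> 0" using that gauss_borel_H(1)[OF assms] by simp
    then obtain \<beta> where "H \<alpha> \<beta> \<noteq> 0" "sinv S \<gamma> \<beta> \<noteq> 0"
      by (auto elim: smat_mult_nonzero simp: stranspose_def)
    then have "mdeg \<alpha> = mdeg \<beta>" "\<not> mdeg \<gamma> < mdeg \<beta>"
      using H block_lower_unitriangular_zero[OF sinv_block_lower_unitriangular(1)[OF S]]
      by (auto simp: block_diagonal_iff)
    then show ?thesis by simp
  qed
  with S show ?thesis unfolding monic_orthogonal_def by (meson not_le)
qed

text \<open>The product S G is block upper triangular by orthogonality, and so is the transpose of
  S; hence their product is block upper triangular. It is also symmetric, so it is block
  diagonal.\<close>

lemma monic_orthogonal_gauss_borel: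
  assumes sym: "stranspose G = G" and mo: "monic_orthogonal G S"
  shows "gauss_borel G S (S **\<^sub>s G **\<^sub>s stranspose S)"
proof -
  let ?T = "sinv S" and ?H = "S **\<^sub>s G **\<^sub>s stranspose S"
  have S: "block_lower_unitriangular S" using mo by (simp add: monic_orthogonal_def)
  note T = sinv_block_lower_unitriangular[OF S]
  have rf: "row_finite S" "row_finite ?T"
    using S T(1) by (auto intro: row_finite_block_lower_unitriangular)
  have upper: "mdeg \<alpha> \<le> mdeg \<gamma>" if "?H \<alpha> \<gamma> \<noteq> 0" for \<alpha> \<gamma>
  proof -
    obtain \<beta> where "(S **\<^sub>s G) \<alpha> \<beta> \<noteq> 0" "S \<gamma> \<beta> \<noteq> 0"
      using \<open>?H \<alpha> \<gamma> \<noteq> 0\<close> by (auto elim: smat_mult_nonzero simp: stranspose_def)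
    then have "\<not> mdeg \<beta> < mdeg \<alpha>" "\<not> mdeg \<gamma> < mdeg \<beta>"
      using mo block_lower_unitriangular_zero[OF S] by (auto simp: monic_orthogonal_def)
    then show ?thesis by simp
  qed
  have "stranspose ?H = S **\<^sub>s (G **\<^sub>s stranspose S)" by (simp add: stranspose_mult sym)
  also have "\<dots> = ?H" by (rule smat_mult_assoc_rc[symmetric]) (simp_all add: rf)
  finally have "?H \<gamma> \<alpha> = ?H \<alpha> \<gamma>" for \<alpha> \<gamma> by (metis stranspose_def)
  with upper have H: "block_diagonal ?H" unfolding block_diagonal_iff by (metis le_antisym)
  have "?T **\<^sub>s ?H = (?T **\<^sub>s (S **\<^sub>s G)) **\<^sub>s stranspose S"
    by (rule smat_mult_assoc_rc[symmetric]) (simp_all add: rf)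
  also have "?T **\<^sub>s (S **\<^sub>s G) = G"
    using smat_mult_assoc_rr[OF rf(2,1), of G] T(3) by simp
  finally have "?T **\<^sub>s ?H **\<^sub>s stranspose ?T = G **\<^sub>s (stranspose S **\<^sub>s stranspose ?T)"
    by (simp add: smat_mult_assoc_cc rf)
  also have "\<dots> = G" using T(3) by (simp flip: stranspose_mult)
  finally show ?thesis using S H by (simp add: gauss_borel_def)
qed

text \<open>The factors S of Gauss-Borel factorizations are exactly the monic orthogonal matrices,
  so existence and uniqueness of the latter resolve the definite descriptions \<open>gb_S\<close>
  and \<open>gb_H\<close>.\<close>

lemma gb_SH:
  assumes sym: "stranspose (moment_matrix \<mu>) = moment_matrix \<mu>"
    and C: "trunc_inverse (moment_matrix \<mu>) C"
  shows "monic_orthogonal (moment_matrix \<mu>) (gb_S \<mu>)"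
    and "gauss_borel (moment_matrix \<mu>) (gb_S \<mu>) (gb_H \<mu>)"
    and "gb_H \<mu> = gb_S \<mu> **\<^sub>s moment_matrix \<mu> **\<^sub>s stranspose (gb_S \<mu>)"
proof -
  let ?G = "moment_matrix \<mu>"
  obtain S where S: "monic_orthogonal ?G S" using monic_orthogonal_exists[OF C] by blast
  have "gb_S \<mu> = S"
    unfolding gb_S_def
  proof (rule the_equality)
    show "\<exists>H. gauss_borel ?G S H" using monic_orthogonal_gauss_borel[OF sym S] by blast
    show "S' = S" if "\<exists>H. gauss_borel ?G S' H" for S'
      using that gauss_borel_monic_orthogonal monic_orthogonal_unique[OF C _ S] by blast
  qed
  with S show mo: "monic_orthogonal ?G (gb_S \<mu>)" by simp
  note gb = monic_orthogonal_gauss_borel[OF sym mo]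
  show eq: "gb_H \<mu> = gb_S \<mu> **\<^sub>s ?G **\<^sub>s stranspose (gb_S \<mu>)"
    unfolding gb_H_def by (rule the_equality) (use gb gauss_borel_H(2) in auto)
  show "gauss_borel ?G (gb_S \<mu>) (gb_H \<mu>)" using gb eq by simp
qed

text \<open>The block \<open>H\<^sub>[\<^sub>k\<^sub>]\<^sup>-\<^sup>1\<close> is the last diagonal block of the inverse of \<open>G\<close> truncated to degree \<open>\<le> k\<close>.\<close>

lemma gauss_borel_H_inverse:
  assumes sym: "stranspose G = G" and C: "trunc_inverse G C" and gb: "gauss_borel G S H"
  obtains K where "block_diagonal K" "H **\<^sub>s K = sone_on UNIV" "K **\<^sub>s H = sone_on UNIV"
proof -
  define K where "K = (\<lambda>\<alpha> \<beta>. if mdeg \<alpha> = mdeg \<beta> then C (Suc (mdeg \<alpha>)) \<alpha> \<beta> else 0)"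
  have K: "block_diagonal K" by (simp add: block_diagonal_iff K_def)
  have S: "block_lower_unitriangular S" and H: "block_diagonal H"
    using gb by (simp_all add: gauss_borel_def)
  note mo = gauss_borel_monic_orthogonal[OF gb]
  have SG_low: "(S **\<^sub>s G) \<alpha> \<beta> = 0" if "mdeg \<beta> < mdeg \<alpha>" for \<alpha> \<beta>
    using mo that by (simp add: monic_orthogonal_def)
  \<comment> \<open>In the product of S G with the transpose of S, terms of degree below |\<alpha>|
    vanish by orthogonality, and in degrees from |\<alpha>| = |\<beta>| on row \<beta> of S is a row
    of the identity.\<close>
  have SG_diag: "(S **\<^sub>s G) \<alpha> \<beta> = H \<alpha> \<beta>" if "mdeg \<alpha> = mdeg \<beta>" for \<alpha> \<beta>
  proof -
    have "H \<alpha> \<beta> = (S **\<^sub>s G **\<^sub>s stranspose S) \<alpha> \<beta>" using gauss_borel_H(2)[OF gb] by simp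
    also have "\<dots> = (\<Sum>\<gamma>\<in>{\<beta>}. (S **\<^sub>s G) \<alpha> \<gamma> * stranspose S \<gamma> \<beta>)"
    proof (rule smat_mult_sum)
      fix \<gamma> assume "\<gamma> \<notin> {\<beta>}"
      then show "(S **\<^sub>s G) \<alpha> \<gamma> * stranspose S \<gamma> \<beta> = 0"
        using SG_low[of \<gamma> \<alpha>] S that
        by (cases "mdeg \<gamma> < mdeg \<alpha>") (auto simp: stranspose_def block_lower_unitriangular_iff)
    qed simp
    also have "\<dots> = (S **\<^sub>s G) \<alpha> \<beta>" using S by (simp add: stranspose_def block_lower_unitriangular_iff)
    finally show ?thesis by simp
  qed
  have "(H **\<^sub>s K) \<alpha> \<delta> = (if \<alpha> = \<delta> then 1 else 0)" for \<alpha> \<delta>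
  proof (cases "mdeg \<alpha> = mdeg \<delta>")
    case False
    then have "H \<alpha> \<beta> * K \<beta> \<delta> = 0" for \<beta>
      using H K by (cases "mdeg \<alpha> = mdeg \<beta>") (auto simp: block_diagonal_iff)
    then have "(H **\<^sub>s K) \<alpha> \<delta> = 0" using smat_mult_sum[of "{}" H \<alpha> K \<delta>] by simp
    with False show ?thesis by auto
  next
    case True
    define k where "k = mdeg \<alpha>"
    have "(H **\<^sub>s K) \<alpha> \<delta> = (\<Sum>\<gamma> | mdeg \<gamma> < Suc k. H \<alpha> \<gamma> * K \<gamma> \<delta>)"
      by (rule smat_mult_sum[OF finite_mdeg_less]) (use H in \<open>auto simp: block_diagonal_iff k_def\<close>)
    \<comment> \<open>Both sides agree term by term. In degrees below k the entries of H and of S G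
      in row \<alpha> are 0; in degree k these entries coincide, and K is \<open>C (Suc k)\<close>
      by definition.\<close>
    also have "\<dots> = (\<Sum>\<gamma> | mdeg \<gamma> < Suc k. (S **\<^sub>s G) \<alpha> \<gamma> * C (Suc k) \<gamma> \<delta>)"
    proof (rule sum.cong[OF refl])
      fix \<gamma> :: "'a mindex" assume "\<gamma> \<in> {\<gamma>. mdeg \<gamma> < Suc k}"
      then show "H \<alpha> \<gamma> * K \<gamma> \<delta> = (S **\<^sub>s G) \<alpha> \<gamma> * C (Suc k) \<gamma> \<delta>"
        using SG_low[of \<gamma> \<alpha>] SG_diag[of \<alpha> \<gamma>] H True
        by (cases "mdeg \<gamma> = k") (auto simp: K_def k_def block_diagonal_iff)
    qed
    also have "\<dots> = (\<Sum>\<gamma> | mdeg \<gamma> < Suc k. (\<Sum>\<beta> | mdeg \<beta> < Suc k. S \<alpha> \<beta> * G \<beta> \<gamma>) * C (Suc k) \<gamma> \<delta>)"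
      by (simp add: lower_mult_sum[OF S, of \<alpha> "Suc k"] k_def)
    also have "\<dots> = S \<alpha> \<delta>"
      by (rule trunc_inverse_right[OF C]) (simp add: k_def True)
    also have "\<dots> = (if \<alpha> = \<delta> then 1 else 0)"
      using S True by (simp add: block_lower_unitriangular_iff)
    finally show ?thesis .
  qed
  then have HK: "H **\<^sub>s K = sone_on UNIV" by (simp add: sone_on_def fun_eq_iff)
  have rfS: "row_finite S" using S by (rule row_finite_block_lower_unitriangular)
  have "stranspose H = stranspose (S **\<^sub>s G **\<^sub>s stranspose S)"
    using gauss_borel_H(2)[OF gb] by simp
  also have "\<dots> = S **\<^sub>s (G **\<^sub>s stranspose S)" by (simp add: stranspose_mult sym)
  also have "\<dots> = H"
    using gauss_borel_H(2)[OF gb] smat_mult_assoc_rc[of S "stranspose S" G] rfS by simp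
  finally have symH: "stranspose H = H" .
  \<comment> \<open>As H is symmetric, the transpose of the right inverse K is a left inverse. A
    left and a right inverse coincide.\<close>
  have "stranspose K **\<^sub>s H = sone_on UNIV"
    using HK symH by (metis stranspose_mult stranspose_sone_on)
  moreover have "stranspose K = stranspose K **\<^sub>s (H **\<^sub>s K)" using HK by simp
  moreover have "\<dots> = (stranspose K **\<^sub>s H) **\<^sub>s K"
    by (rule smat_mult_assoc_rr[symmetric]) (intro row_finite_block_diagonal H block_diagonal_stranspose K)+
  ultimately have "K **\<^sub>s H = sone_on UNIV" by simp
  with K HK that show thesis by blast
qed

section \<open>Monomials\<close>

text \<open>Induction on the set \<open>A\<close> of variables. The third hypothesis, that exponents
  in \<open>F\<close> are told apart by their values on \<open>A\<close>, makes \<open>F\<close> a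
  singleton in the base case. Points are functions, so that a single coordinate can be
  updated.\<close>

lemma monomials_independent_aux:
  fixes v :: "'d mindex \<Rightarrow> real"
  assumes "finite A" "finite F"
    and "\<And>\<beta> \<beta>'. \<beta> \<in> F \<Longrightarrow> \<beta>' \<in> F \<Longrightarrow> (\<And>a. a \<in> A \<Longrightarrow> \<beta> a = \<beta>' a) \<Longrightarrow> \<beta> = \<beta>'"
    and "\<And>x. (\<Sum>\<beta>\<in>F. v \<beta> * (\<Prod>a\<in>A. x a ^ \<beta> a)) = 0"
    and "\<gamma> \<in> F"
  shows "v \<gamma> = 0"
  using assms
proof (induction A arbitrary: F rule: finite_induct)
  case empty
  then have "F = {\<gamma>}" by blast
  then show ?case using empty.prems(3)[of undefined] by simp
next
  case (insert a A)
  let ?p = "\<lambda>x. \<Sum>\<beta>\<in>F. monom (v \<beta> * (\<Prod>b\<in>A. x b ^ \<beta> b)) (\<beta> a)"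
  \<comment> \<open>With the variables in \<open>A\<close> frozen, the sum is a polynomial in the
    variable \<open>a\<close> alone, and it vanishes at every real t.\<close>
  have "poly (?p x) t = 0" for x t
  proof -
    have prod: "(\<Prod>b\<in>A. (x(a := t)) b ^ \<beta> b) = (\<Prod>b\<in>A. x b ^ \<beta> b)" for \<beta> :: "'d mindex"
      by (rule prod.cong) (use insert.hyps in auto)
    have "poly (?p x) t = (\<Sum>\<beta>\<in>F. v \<beta> * (\<Prod>b\<in>insert a A. (x(a := t)) b ^ \<beta> b))"
      using insert.hyps by (simp add: poly_sum poly_monom prod ac_simps fun_upd_same del: fun_upd_apply)
    also have "\<dots> = 0" by (rule insert.prems(3))
    finally show ?thesis .
  qed
  then have p: "?p x = 0" for x using poly_all_0_iff_0 by blast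
  \<comment> \<open>The coefficient of degree \<open>\<gamma> a\<close> collects exactly these
    exponents. They agree at \<open>a\<close>, so they are already told apart by \<open>A\<close>,
    as the induction hypothesis demands.\<close>
  let ?F = "{\<beta>\<in>F. \<beta> a = \<gamma> a}"
  show ?case
  proof (rule insert.IH[of ?F])
    show "(\<Sum>\<beta>\<in>?F. v \<beta> * (\<Prod>b\<in>A. x b ^ \<beta> b)) = 0" for x
    proof -
      have "(\<Sum>\<beta>\<in>?F. v \<beta> * (\<Prod>b\<in>A. x b ^ \<beta> b)) = coeff (?p x) (\<gamma> a)"
        using insert.prems(1) by (simp add: coeff_sum sum.inter_filter cong: if_cong)
      then show ?thesis using p by simp
    qed
    show "\<beta> = \<beta>'" if "\<beta> \<in> ?F" "\<beta>' \<in> ?F" "\<And>b. b \<in> A \<Longrightarrow> \<beta> b = \<beta>' b" for \<beta> \<beta>'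
      by (rule insert.prems(2)) (use that in auto)
  qed (use insert.prems(1,4) in simp_all)
qed

lemma monomials_independent:
  fixes v :: "'d::finite mindex \<Rightarrow> real"
  assumes "finite F" "\<And>x. (\<Sum>\<beta>\<in>F. v \<beta> * chi x \<beta>) = 0" "\<gamma> \<in> F"
  shows "v \<gamma> = 0"
proof (rule monomials_independent_aux[of UNIV F v \<gamma>])
  show "(\<Sum>\<beta>\<in>F. v \<beta> * (\<Prod>a\<in>UNIV. x a ^ \<beta> a)) = 0" for x
    using assms(2)[of "\<chi> a. x a"] by (simp add: chi_def)
qed (use assms in auto)

lemma smat_mult_vec_sum:
  assumes "finite F" "\<And>\<beta>. \<beta> \<notin> F \<Longrightarrow> A \<alpha> \<beta> = 0"
  shows "(A *v\<^sub>s v) \<alpha> = (\<Sum>\<beta>\<in>F. A \<alpha> \<beta> * v \<beta>)"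
  unfolding smat_mult_vec_eq[where \<gamma> = \<alpha>] by (rule smat_mult_sum) (use assms in auto)

text \<open>The rows of a row finite matrix are coefficient vectors of polynomials. Matrix
  identities for \<eta> and \<Lambda> can thus be checked as identities between functions of
  x.\<close>

lemma smat_eq_if_chi_eq:
  fixes A B :: "'d::finite smat"
  assumes "row_finite A" "row_finite B" "\<And>x. A *v\<^sub>s chi x = B *v\<^sub>s chi x"
  shows "A = B"
proof (intro ext)
  fix \<alpha> \<gamma>
  let ?F = "insert \<gamma> ({\<beta>. A \<alpha> \<beta> \<noteq> 0} \<union> {\<beta>. B \<alpha> \<beta> \<noteq> 0})"
  have fin: "finite ?F" using assms(1,2) by (simp add: row_finite_def)
  have "(A *v\<^sub>s chi x) \<alpha> = (\<Sum>\<beta>\<in>?F. A \<alpha> \<beta> * chi x \<beta>)"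
    "(B *v\<^sub>s chi x) \<alpha> = (\<Sum>\<beta>\<in>?F. B \<alpha> \<beta> * chi x \<beta>)" for x
    by (rule smat_mult_vec_sum[OF fin], simp)+
  then have "(\<Sum>\<beta>\<in>?F. (A \<alpha> \<beta> - B \<alpha> \<beta>) * chi x \<beta>) = (A *v\<^sub>s chi x) \<alpha> - (B *v\<^sub>s chi x) \<alpha>" for x
    by (simp only: left_diff_distrib sum_subtractf)
  then have "(\<Sum>\<beta>\<in>?F. (A \<alpha> \<beta> - B \<alpha> \<beta>) * chi x \<beta>) = 0" for x using assms(3) by simp
  from monomials_independent[OF fin this, of \<gamma>] show "A \<alpha> \<gamma> = B \<alpha> \<gamma>" by simp
qed

lemma chi_add: "chi x \<alpha> * chi x \<beta> = chi x (\<lambda>a. \<alpha> a + \<beta> a)"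
  by (simp add: chi_def power_add prod.distrib)

lemma chi_shift: "shift a *v\<^sub>s chi x = (\<lambda>\<alpha>. vec_nth x a * chi x \<alpha>)"
proof
  fix \<alpha> :: "'a mindex"
  have "(shift a *v\<^sub>s chi x) \<alpha> = chi x (\<alpha>(a := \<alpha> a + 1))"
    by (subst smat_mult_vec_sum[of "{\<alpha>(a := \<alpha> a + 1)}"]) (auto simp: shift_def)
  also have "\<dots> = vec_nth x a * chi x \<alpha>"
    unfolding chi_def by (subst (1 2) prod.remove[of UNIV a]) simp_all
  finally show "(shift a *v\<^sub>s chi x) \<alpha> = vec_nth x a * chi x \<alpha>" .
qed

section \<open>Symmetric tensors\<close>

text \<open>An orbit of tensor positions under permutation; it turns out to be the support of
  \<open>sym_basis \<alpha>\<close>.\<close>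

definition lists_of :: "'d::finite mindex \<Rightarrow> 'd list set" where
  "lists_of \<alpha> = {is. \<forall>a. count_list is a = \<alpha> a}"

lemma count_list_mset: "count_list xs a = count (mset xs) a"
  by (induction xs) auto

lemma length_lists_of: "is \<in> lists_of \<alpha> \<Longrightarrow> length is = mdeg \<alpha>"
proof -
  assume "is \<in> lists_of \<alpha>"
  then have "mdeg \<alpha> = (\<Sum>a\<in>UNIV. count_list is a)" by (simp add: mdeg_def lists_of_def)
  also have "\<dots> = (\<Sum>a\<in>set is. count_list is a)"
    by (rule sum.mono_neutral_right) (auto simp: count_list_0_iff)
  also have "\<dots> = length is" by (rule sum_count_set) auto
  finally show ?thesis by simp
qed

lemma lists_of_eqD: "is \<in> lists_of \<alpha> \<Longrightarrow> js \<in> lists_of \<alpha> \<Longrightarrow> mset is = mset js"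
  by (intro multiset_eqI) (simp add: lists_of_def count_list_mset)

lemma lists_of_unique: "is \<in> lists_of \<alpha> \<Longrightarrow> is \<in> lists_of \<beta> \<Longrightarrow> \<alpha> = \<beta>"
  by (auto simp: lists_of_def)

lemma lists_of_count: "is \<in> lists_of (count_list is)"
  by (simp add: lists_of_def)

text \<open>The representative of the orbit whose unit vectors are the factors in
  \<open>sym_basis \<alpha>\<close>.\<close>

definition canonical_list :: "'d::{finite,linorder} mindex \<Rightarrow> 'd list" where
  "canonical_list \<alpha> = concat (map (\<lambda>a. replicate (\<alpha> a) a) (sorted_list_of_set UNIV))"

lemma count_list_replicate: "count_list (replicate n a) b = (if a = b then n else 0)"
  by (induction n) auto

lemma canonical_list: "canonical_list \<alpha> \<in> lists_of \<alpha>"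
proof -
  have "count_list (concat (map (\<lambda>a. replicate (\<alpha> a) a) xs)) b = (if b \<in> set xs then \<alpha> b else 0)"
    if "distinct xs" for xs and b :: 'a
    using that by (induction xs) (auto simp: count_list_replicate)
  then show ?thesis by (simp add: lists_of_def canonical_list_def)
qed

text \<open>The lists are the arrangements of one multiset. The known count is a quotient of natural
  numbers, and divisibility turns it into a real quotient.\<close>

lemma card_lists_of:
  fixes \<alpha> :: "'d::{finite,linorder} mindex"
  shows "real (card (lists_of \<alpha>)) = multinomial \<alpha>"
proof -
  let ?M = "mset (canonical_list \<alpha>)"
  have cnt: "count ?M a = \<alpha> a" for a
    using canonical_list[of \<alpha>] by (simp add: lists_of_def count_list_mset)
  have count_zero: "\<alpha> a = 0" if "a \<notin># ?M" for a
    using that cnt[of a] by (metis count_eq_zero_iff)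
  have "lists_of \<alpha> = permutations_of_multiset ?M"
    by (auto simp: permutations_of_multiset_def lists_of_def count_list_mset multiset_eq_iff cnt)
  then have card: "real (card (lists_of \<alpha>)) = real (fact (size ?M) div (\<Prod>a\<in>set_mset ?M. fact (count ?M a)))"
    by (simp add: card_permutations_of_multiset)
  have "(\<Prod>a\<in>set_mset ?M. fact (count ?M a)) = (\<Prod>a\<in>UNIV. fact (\<alpha> a) :: nat)"
    by (rule prod.mono_neutral_cong_left) (auto simp: cnt simp del: set_mset_mset dest: count_zero)
  moreover have "(\<Prod>a\<in>set_mset ?M. fact (count ?M a)) dvd (fact (size ?M) :: nat)"
    using card_permutations_of_multiset(2) by blast
  moreover have "size ?M = mdeg \<alpha>" using length_lists_of[OF canonical_list[of \<alpha>]] by simp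
  ultimately show ?thesis unfolding card
    by (simp add: real_of_nat_div multinomial_def)
qed

lemma multinomial_nonzero: "multinomial \<alpha> \<noteq> 0"
  by (simp add: multinomial_def)

lemma finite_lists_length: "finite {is :: 'd::finite list. length is = k}"
  using finite_lists_length_eq[of "UNIV :: 'd set" k] by simp

lemma finite_lists_of: "finite (lists_of \<alpha>)"
  by (rule finite_subset[OF _ finite_lists_length[of "mdeg \<alpha>"]]) (auto dest: length_lists_of)

lemma tensor_prod_axis:
  "tensor_prod (map (\<lambda>a. axis a 1) js) is = (if is = js then 1 else 0)"
proof (cases "length is = length js")
  case True
  have "(\<Prod>j<length js. (if is ! j = js ! j then 1 else 0 :: real)) = (if is = js then 1 else 0)"
  proof (cases "is = js")
    case False
    with True obtain j where "j < length js" "is ! j \<noteq> js ! j" by (metis nth_equalityI)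
    with False show ?thesis by (auto intro!: prod_zero bexI[of _ j])
  qed simp
  with True show ?thesis by (simp add: tensor_prod_def axis_def)
qed (auto simp: tensor_prod_def)

lemma sym_basis_eq:
  "sym_basis \<alpha> is = (\<Sum>\<sigma> | \<sigma> permutes {..<mdeg \<alpha>}.
      if is = permute_list \<sigma> (canonical_list \<alpha>) then 1 else 0) / fact (mdeg \<alpha>)"
proof -
  have "concat (map (\<lambda>a. replicate (\<alpha> a) (axis a (1::real))) (sorted_list_of_set UNIV))
      = map (\<lambda>a. axis a 1) (canonical_list \<alpha>)"
    by (simp add: canonical_list_def map_concat comp_def)
  then show ?thesis
    unfolding sym_basis_def sym_prod_def
    using length_lists_of[OF canonical_list[of \<alpha>]]
    by (auto simp: tensor_prod_axis permute_list_map intro!: sum.cong)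
qed

text \<open>By symmetry \<open>sym_basis \<alpha>\<close> is constant on \<open>lists_of \<alpha>\<close>, and its entries sum to \<open>1\<close>; this gives the
  value without counting the permutations that fix a list.\<close>

lemma sym_basis:
  "sym_basis \<alpha> is = (if is \<in> lists_of \<alpha> then 1 / multinomial \<alpha> else 0)"
proof -
  let ?L = "canonical_list \<alpha>" and ?k = "mdeg \<alpha>" and ?P = "{\<sigma>. \<sigma> permutes {..<mdeg \<alpha>}}"
  have len: "length ?L = ?k" by (rule length_lists_of[OF canonical_list])
  have perm: "permute_list \<sigma> ?L \<in> lists_of \<alpha>" if "\<sigma> permutes {..<?k}" for \<sigma>
    using mset_permute_list[of \<sigma> ?L] that len canonical_list[of \<alpha>]
    by (simp add: lists_of_def count_list_mset)
  have outside: "sym_basis \<alpha> is = 0" if "is \<notin> lists_of \<alpha>" for "is"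
  proof -
    have "is \<noteq> permute_list \<sigma> ?L" if "\<sigma> permutes {..<?k}" for \<sigma>
      using perm[OF that] \<open>is \<notin> lists_of \<alpha>\<close> by blast
    then show ?thesis unfolding sym_basis_eq by simp
  qed
  have const: "sym_basis \<alpha> is = sym_basis \<alpha> js" if i: "is \<in> lists_of \<alpha>" and j: "js \<in> lists_of \<alpha>" for "is" js
  proof -
    obtain \<tau> where \<tau>: "\<tau> permutes {..<length js}" "permute_list \<tau> js = is"
      using mset_eq_permutation[OF lists_of_eqD[OF i j]] by blast
    have \<tau>': "\<tau> permutes {..<?k}" using \<tau>(1) length_lists_of[OF j] by simp
    have "(\<Sum>\<sigma>\<in>?P. if js = permute_list \<sigma> ?L then 1 else 0 :: real)
        = (\<Sum>\<sigma>\<in>?P. if is = permute_list (\<sigma> \<circ> \<tau>) ?L then 1 else 0)"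
    proof (rule sum.cong[OF refl])
      fix \<sigma> assume "\<sigma> \<in> ?P"
      have eq: "permute_list (\<sigma> \<circ> \<tau>) ?L = permute_list \<tau> (permute_list \<sigma> ?L)"
        by (rule permute_list_compose) (use \<tau>' len in simp)
      \<comment> \<open>On lists of length k the permutation of positions by \<tau> is undone by
        that of its inverse, so applying \<tau> to both sides of an equation of lists loses
        nothing.\<close>
      have inj: "xs = ys" if "permute_list \<tau> xs = permute_list \<tau> ys" "length xs = ?k" "length ys = ?k"
        for xs ys :: "'a list"
      proof -
        have "permute_list (inv_into UNIV \<tau>) (permute_list \<tau> zs) = zs" if "length zs = ?k" for zs :: "'a list"
        proof -
          have "inv_into UNIV \<tau> permutes {..<length zs}" using permutes_inv[OF \<tau>'] that by simp
          from permute_list_compose[OF this, of \<tau>] show ?thesis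
            by (simp add: permutes_inv_o(1)[OF \<tau>'])
        qed
        then show ?thesis by (metis that)
      qed
      show "(if js = permute_list \<sigma> ?L then 1 else 0 :: real)
          = (if is = permute_list (\<sigma> \<circ> \<tau>) ?L then 1 else 0)"
      proof (rule if_cong[OF _ refl refl])
        show "js = permute_list \<sigma> ?L \<longleftrightarrow> is = permute_list (\<sigma> \<circ> \<tau>) ?L"
          unfolding eq \<tau>(2)[symmetric]
          by (metis inj len length_lists_of[OF j] length_permute_list)
      qed
    qed
    also have "\<dots> = (\<Sum>\<sigma>\<in>?P. if is = permute_list \<sigma> ?L then 1 else 0)"
      by (rule sum_permutations_compose_right[OF \<tau>', of "\<lambda>\<sigma>. if is = permute_list \<sigma> ?L then 1 else 0", symmetric])
    finally show ?thesis unfolding sym_basis_eq by simp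
  qed
  \<comment> \<open>Each of the k! permutations sends the canonical list to exactly one list of the
    orbit, so it contributes exactly 1 to the total.\<close>
  have "(\<Sum>is\<in>lists_of \<alpha>. sym_basis \<alpha> is) = (\<Sum>\<sigma>\<in>?P. 1) / fact ?k"
    unfolding sym_basis_eq sum_divide_distrib[symmetric]
    by (subst sum.swap, intro arg_cong2[of _ _ _ _ "(/)"] sum.cong refl)
       (simp add: sum.delta[OF finite_lists_of] perm)
  also have "\<dots> = 1" by (simp add: card_permutations)
  finally have one: "(\<Sum>is\<in>lists_of \<alpha>. sym_basis \<alpha> is) = 1" .
  show ?thesis
  proof (cases "is \<in> lists_of \<alpha>")
    case True
    have "(\<Sum>js\<in>lists_of \<alpha>. sym_basis \<alpha> js) = (\<Sum>js\<in>lists_of \<alpha>. sym_basis \<alpha> is)"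
      by (rule sum.cong[OF refl const[OF _ True]])
    with one True card_lists_of[of \<alpha>] multinomial_nonzero[of \<alpha>] show ?thesis
      by (simp add: field_simps)
  qed (simp add: outside)
qed

section \<open>The symmetric powers acting on monomials\<close>

lemma chi_lists_of:
  assumes "is \<in> lists_of \<alpha>"
  shows "chi x \<alpha> = (\<Prod>m<length is. vec_nth x (is ! m))"
proof -
  have "(\<Prod>m<length is. vec_nth x (is ! m)) = (\<Prod>a\<in>UNIV. vec_nth x a ^ count_list is a)"
  proof (induction "is")
    case (Cons b "is")
    have "(\<Prod>a\<in>UNIV. vec_nth x a ^ count_list (b # is) a)
        = (\<Prod>a\<in>UNIV. (if a = b then vec_nth x a else 1) * vec_nth x a ^ count_list is a)"
      by (rule prod.cong) auto
    also have "\<dots> = vec_nth x b * (\<Prod>a\<in>UNIV. vec_nth x a ^ count_list is a)"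
      by (simp add: prod.distrib)
    finally show ?case using Cons by (simp add: prod.lessThan_Suc_shift del: prod.lessThan_Suc)
  qed simp
  with assms show ?thesis by (simp add: chi_def lists_of_def)
qed

text \<open>Distributivity, with the choice of one summand per factor coded as a list. The factor
  with index 0 is split off, since lists grow at the front; this shifts \<open>f\<close>, which is
  therefore arbitrary in the induction.\<close>

lemma prod_sum_lists:
  fixes f :: "nat \<Rightarrow> 'd::finite \<Rightarrow> real"
  shows "(\<Prod>m<k. \<Sum>j\<in>UNIV. f m j) = (\<Sum>js | length js = k. \<Prod>m<k. f m (js ! m))"
proof (induction k arbitrary: f)
  case (Suc k)
  have bij: "bij_betw (\<lambda>(j, js). j # js) (UNIV \<times> {js :: 'd list. length js = k}) {js. length js = Suc k}"
    by (rule bij_betwI[where g = "\<lambda>js. (hd js, tl js)"]) (auto simp: length_Suc_conv)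
  have "(\<Prod>m<Suc k. \<Sum>j\<in>UNIV. f m j) = (\<Sum>j\<in>UNIV. f 0 j) * (\<Sum>js | length js = k. \<Prod>m<k. f (Suc m) (js ! m))"
    by (simp add: prod.lessThan_Suc_shift Suc del: prod.lessThan_Suc)
  also have "\<dots> = (\<Sum>(j, js)\<in>UNIV \<times> {js. length js = k}. f 0 j * (\<Prod>m<k. f (Suc m) (js ! m)))"
    by (simp add: sum_product sum.cartesian_product)
  also have "\<dots> = (\<Sum>js | length js = Suc k. \<Prod>m<Suc k. f m (js ! m))"
    by (subst sum.reindex_bij_betw[OF bij, symmetric], rule sum.cong)
       (auto simp: prod.lessThan_Suc_shift simp del: prod.lessThan_Suc)
  finally show ?case .
qed simp

text \<open>For \<open>\<beta>\<close> of degree \<open>length is\<close>, the coefficient of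
  x^\<beta> in the product of the linear forms (Rx)_i, with i running through
  \<open>is\<close>.\<close>

definition tensor_coeff :: "real ^ 'd ^ 'd \<Rightarrow> 'd::finite list \<Rightarrow> 'd mindex \<Rightarrow> real" where
  "tensor_coeff R is \<beta> = (\<Sum>js\<in>lists_of \<beta>. \<Prod>m<length is. vec_nth (vec_nth R (is ! m)) (js ! m))"

lemma chi_matrix_vector:
  fixes R :: "real ^ 'd::finite ^ 'd"
  assumes i: "is \<in> lists_of \<alpha>" and k: "mdeg \<alpha> = k"
  shows "chi (R *v x) \<alpha> = (\<Sum>\<beta>\<in>mlevel k. tensor_coeff R is \<beta> * chi x \<beta>)"
proof -
  have len: "length is = k" using length_lists_of[OF i] k by simp
  let ?f = "\<lambda>js. \<Prod>m<k. vec_nth (vec_nth R (is ! m)) (js ! m)"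
  have "chi (R *v x) \<alpha> = (\<Prod>m<k. \<Sum>j\<in>UNIV. vec_nth (vec_nth R (is ! m)) j * vec_nth x j)"
    by (simp add: chi_lists_of[OF i] len matrix_vector_mult_def)
  also have "\<dots> = (\<Sum>js | length js = k. ?f js * (\<Prod>m<k. vec_nth x (js ! m)))"
    by (simp add: prod_sum_lists prod.distrib)
  \<comment> \<open>The words of length k are grouped by their letter counts; all words of one group
    yield the same monomial in x.\<close>
  also have "{js :: 'd list. length js = k} = (\<Union>\<beta>\<in>mlevel k. lists_of \<beta>)"
    by (auto simp: mlevel_def length_lists_of
        intro!: exI[where x = "count_list _"] length_lists_of[OF lists_of_count, symmetric] lists_of_count)
  also have "(\<Sum>js\<in>(\<Union>\<beta>\<in>mlevel k. lists_of \<beta>). ?f js * (\<Prod>m<k. vec_nth x (js ! m)))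
      = (\<Sum>\<beta>\<in>mlevel k. \<Sum>js\<in>lists_of \<beta>. ?f js * (\<Prod>m<k. vec_nth x (js ! m)))"
    by (rule sum.UNION_disjoint) (auto simp: finite_mlevel finite_lists_of dest: lists_of_unique)
  also have "\<dots> = (\<Sum>\<beta>\<in>mlevel k. tensor_coeff R is \<beta> * chi x \<beta>)"
    unfolding tensor_coeff_def sum_distrib_right len
    by (intro sum.cong refl) (auto simp: chi_lists_of mlevel_def dest: length_lists_of)
  finally show ?thesis .
qed

lemma tensor_power_sym_basis:
  assumes \<beta>: "\<beta> \<in> mlevel k"
  shows "tensor_power R k (sym_basis \<beta>) is
    = (if length is = k then tensor_coeff R is \<beta> / multinomial \<beta> else 0)"
proof (cases "length is = k")
  case True
  let ?f = "\<lambda>js. \<Prod>m<k. vec_nth (vec_nth R (is ! m)) (js ! m)"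
  have "(\<Sum>js | length js = k. ?f js * sym_basis \<beta> js) = (\<Sum>js\<in>lists_of \<beta>. ?f js * sym_basis \<beta> js)"
    by (rule sum.mono_neutral_right)
       (use \<beta> finite_lists_length in \<open>auto simp: sym_basis mlevel_def dest: length_lists_of\<close>)
  also have "\<dots> = (\<Sum>js\<in>lists_of \<beta>. ?f js / multinomial \<beta>)"
    by (rule sum.cong) (auto simp: sym_basis)
  finally show ?thesis using True
    by (simp add: tensor_power_def tensor_coeff_def sum_divide_distrib)
qed (simp add: tensor_power_def)

text \<open>Both lists expand the same polynomial \<chi>(Rx)_\<alpha>, so independence of monomials
  equates the coefficients without any reindexing by permutations.\<close>

lemma tensor_coeff_cong:
  fixes R :: "real ^ 'd::finite ^ 'd"
  assumes "is \<in> lists_of \<alpha>" "is' \<in> lists_of \<alpha>" "mdeg \<beta> = mdeg \<alpha>"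
  shows "tensor_coeff R is \<beta> = tensor_coeff R is' \<beta>"
proof -
  have "(\<Sum>\<beta>\<in>mlevel (mdeg \<alpha>). (tensor_coeff R is \<beta> - tensor_coeff R is' \<beta>) * chi x \<beta>) = 0" for x
    using chi_matrix_vector[OF assms(1) refl, of R x] chi_matrix_vector[OF assms(2) refl, of R x]
    by (simp add: left_diff_distrib sum_subtractf)
  from monomials_independent[OF finite_mlevel this, of \<beta>] show ?thesis
    using assms(3) by (simp add: mlevel_def)
qed

text \<open>The basis tensors have disjoint supports and constant value
  \<open>1 / multinomial \<alpha>\<close> there. So a coordinate is
  \<open>multinomial \<alpha>\<close> times the entry at any list of the orbit, and
  \<open>tensor_coeff_cong\<close> makes the choice of the canonical list immaterial.\<close>

lemma sym_power_matrix:
  assumes "\<alpha> \<in> mlevel k" "\<beta> \<in> mlevel k"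
  shows "sym_power_matrix R k \<alpha> \<beta> = multinomial \<alpha> * tensor_coeff R (canonical_list \<alpha>) \<beta> / multinomial \<beta>"
proof -
  define M where "M = (\<lambda>\<alpha> \<beta>. if \<alpha> \<in> mlevel k \<and> \<beta> \<in> mlevel k
    then multinomial \<alpha> * tensor_coeff R (canonical_list \<alpha>) \<beta> / multinomial \<beta> else 0)"
  \<comment> \<open>At position \<open>is\<close> only the basis tensor labelled by the letter
    counts of \<open>is\<close> is nonzero.\<close>
  have expand: "(\<Sum>\<alpha>\<in>mlevel k. N \<alpha> \<beta> * sym_basis \<alpha> is)
      = (if length is = k then N (count_list is) \<beta> / multinomial (count_list is) else 0)"
    for N :: "'a smat" and \<beta> "is"
  proof -
    have "(\<Sum>\<alpha>\<in>mlevel k. N \<alpha> \<beta> * sym_basis \<alpha> is)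
        = (\<Sum>\<alpha>\<in>mlevel k. if \<alpha> = count_list is then N \<alpha> \<beta> / multinomial \<alpha> else 0)"
      by (rule sum.cong) (auto simp: sym_basis lists_of_def)
    also have "\<dots> = (if length is = k then N (count_list is) \<beta> / multinomial (count_list is) else 0)"
      using length_lists_of[OF lists_of_count, of "is"]
      by (simp add: sum.delta[OF finite_mlevel]) (simp add: mlevel_def)
    finally show ?thesis .
  qed
  have "sym_power_matrix R k = M"
    unfolding sym_power_matrix_def
  proof (rule the_equality, intro conjI allI ballI impI)
    show "\<alpha> \<in> mlevel k" "\<beta> \<in> mlevel k" if "M \<alpha> \<beta> \<noteq> 0" for \<alpha> \<beta>
      using that by (auto simp: M_def split: if_splits)
    show "tensor_power R k (sym_basis \<beta>) = (\<lambda>is. \<Sum>\<alpha>\<in>mlevel k. M \<alpha> \<beta> * sym_basis \<alpha> is)"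
      if \<beta>: "\<beta> \<in> mlevel k" for \<beta>
    proof
      fix "is" :: "'a list"
      let ?\<alpha> = "count_list is"
      show "tensor_power R k (sym_basis \<beta>) is = (\<Sum>\<alpha>\<in>mlevel k. M \<alpha> \<beta> * sym_basis \<alpha> is)"
      proof (cases "length is = k")
        case True
        then have "?\<alpha> \<in> mlevel k" using length_lists_of[OF lists_of_count, of "is"] by (simp add: mlevel_def)
        with True \<beta> show ?thesis
          unfolding expand tensor_power_sym_basis[OF \<beta>]
          using tensor_coeff_cong[OF lists_of_count canonical_list, of \<beta> "is" R] multinomial_nonzero[of ?\<alpha>]
          by (simp add: M_def mlevel_def)
      qed (simp add: expand tensor_power_sym_basis[OF \<beta>])
    qed
  next
    fix N :: "'a smat"
    assume N: "(\<forall>\<alpha> \<beta>. N \<alpha> \<beta> \<noteq> 0 \<longrightarrow> \<alpha> \<in> mlevel k \<and> \<beta> \<in> mlevel k) \<and>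
      (\<forall>\<beta>\<in>mlevel k. tensor_power R k (sym_basis \<beta>) = (\<lambda>is. \<Sum>\<alpha>\<in>mlevel k. N \<alpha> \<beta> * sym_basis \<alpha> is))"
    show "N = M"
    proof (intro ext)
      fix \<alpha> \<beta>
      show "N \<alpha> \<beta> = M \<alpha> \<beta>"
      proof (cases "\<alpha> \<in> mlevel k \<and> \<beta> \<in> mlevel k")
        case True
        let ?L = "canonical_list \<alpha>"
        have L: "count_list ?L = \<alpha>" "length ?L = k"
          using canonical_list[of \<alpha>] length_lists_of[OF canonical_list, of \<alpha>] True
          by (auto simp: lists_of_def mlevel_def)
        have "tensor_coeff R ?L \<beta> / multinomial \<beta> = N \<alpha> \<beta> / multinomial \<alpha>"
          using N True expand[of N \<beta> ?L] tensor_power_sym_basis[of \<beta> k R ?L] L by simp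
        with True multinomial_nonzero[of \<alpha>] show ?thesis by (simp add: M_def field_simps)
      qed (use N in \<open>auto simp: M_def\<close>)
    qed
  qed
  with assms show ?thesis by (simp add: M_def)
qed

lemma sinv_multinomial_matrix:
  "sinv_on (mlevel k) (multinomial_matrix k)
     = (\<lambda>\<alpha> \<beta>. if \<alpha> = \<beta> \<and> \<alpha> \<in> mlevel k then 1 / multinomial \<alpha> else 0)" (is "_ = ?N")
proof (rule sinv_on_eqI)
  have prod: "((\<lambda>\<alpha> \<beta>. if \<alpha> = \<beta> \<and> \<alpha> \<in> mlevel k then f \<alpha> else 0) **\<^sub>s
      (\<lambda>\<alpha> \<beta>. if \<alpha> = \<beta> \<and> \<alpha> \<in> mlevel k then g \<alpha> else 0)) \<alpha> \<beta>
    = (if \<alpha> = \<beta> \<and> \<alpha> \<in> mlevel k then f \<alpha> * g \<alpha> else 0)" for f g and \<alpha> \<beta> :: "'a mindex"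
    by (subst smat_mult_sum[of "{\<alpha>}"]) auto
  show "multinomial_matrix k **\<^sub>s ?N = sone_on (mlevel k)"
    unfolding multinomial_matrix_def by (intro ext) (auto simp: prod sone_on_def multinomial_nonzero)
  show "?N **\<^sub>s multinomial_matrix k = sone_on (mlevel k)"
    unfolding multinomial_matrix_def by (intro ext) (auto simp: prod sone_on_def multinomial_nonzero)
  show "row_finite (multinomial_matrix k :: 'a smat)" "row_finite (?N :: 'a smat)"
    by (auto intro!: row_finite_block_diagonal simp: block_diagonal_iff multinomial_matrix_def)
  show "\<alpha> \<in> mlevel k \<and> \<beta> \<in> mlevel k" if "?N \<alpha> \<beta> \<noteq> 0" for \<alpha> \<beta> :: "'a mindex"
    using that by metis
qed

text \<open>The conjugation cancels both multinomial factors of \<open>sym_power_matrix\<close>, and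
  the plain coefficient of x^\<beta> in \<chi>(Rx)_\<alpha> is left.\<close>

lemma eta_eq:
  assumes "mdeg \<alpha> = k" "mdeg \<beta> = k"
  shows "eta R \<alpha> \<beta> = tensor_coeff R (canonical_list \<alpha>) \<beta>"
proof -
  let ?N = "\<lambda>\<alpha> \<beta>. if \<alpha> = \<beta> \<and> \<alpha> \<in> mlevel k then 1 / multinomial \<alpha> else 0 :: real"
  have lev: "\<alpha> \<in> mlevel k" "\<beta> \<in> mlevel k" using assms by (auto simp: mlevel_def)
  have N: "(?N **\<^sub>s sym_power_matrix R k) \<alpha> \<gamma> = 1 / multinomial \<alpha> * sym_power_matrix R k \<alpha> \<gamma>" for \<gamma>
    by (subst smat_mult_sum[of "{\<alpha>}"]) (use lev in auto)
  have "eta R \<alpha> \<beta> = (?N **\<^sub>s sym_power_matrix R k **\<^sub>s multinomial_matrix k) \<alpha> \<beta>"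
    using assms by (simp add: eta_def eta_block_def sinv_multinomial_matrix)
  also have "\<dots> = 1 / multinomial \<alpha> * sym_power_matrix R k \<alpha> \<beta> * multinomial \<beta>"
    by (subst smat_mult_sum[of "{\<beta>}"]) (use lev in \<open>auto simp: multinomial_matrix_def N\<close>)
  also have "\<dots> = tensor_coeff R (canonical_list \<alpha>) \<beta>"
    by (simp add: sym_power_matrix[OF lev] multinomial_nonzero)
  finally show ?thesis .
qed

lemma eta_block_diagonal: "block_diagonal (eta R)"
  by (simp add: block_diagonal_iff eta_def)

lemma chi_eta: "chi (R *v x) = eta R *v\<^sub>s chi x"
proof
  fix \<alpha>
  have "(eta R *v\<^sub>s chi x) \<alpha> = (\<Sum>\<beta>\<in>mlevel (mdeg \<alpha>). eta R \<alpha> \<beta> * chi x \<beta>)"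
    by (rule smat_mult_vec_sum[OF finite_mlevel]) (auto simp: eta_def mlevel_def)
  also have "\<dots> = (\<Sum>\<beta>\<in>mlevel (mdeg \<alpha>). tensor_coeff R (canonical_list \<alpha>) \<beta> * chi x \<beta>)"
    by (rule sum.cong) (auto simp: eta_eq mlevel_def)
  also have "\<dots> = chi (R *v x) \<alpha>" by (rule chi_matrix_vector[OF canonical_list refl, symmetric])
  finally show "chi (R *v x) \<alpha> = (eta R *v\<^sub>s chi x) \<alpha>" by simp
qed

text \<open>Checked on \<chi>(x), where two applications of \<open>chi_eta\<close> give \<chi>(R R'
  x) = \<chi>(x).\<close>

lemma eta_inverse:
  assumes "R ** R' = Finite_Cartesian_Product.mat 1"
  shows "eta R **\<^sub>s eta R' = sone_on UNIV"
proof (rule smat_eq_if_chi_eq)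
  note rf = row_finite_block_diagonal[OF eta_block_diagonal]
  show "row_finite (eta R **\<^sub>s eta R')" "row_finite (sone_on UNIV :: 'a smat)"
    by (intro row_finite_mult rf row_finite_sone_on)+
  show "(eta R **\<^sub>s eta R') *v\<^sub>s chi x = sone_on UNIV *v\<^sub>s chi x" for x
    by (simp add: smat_mult_vec_assoc rf matrix_vector_mul_assoc assms flip: chi_eta)
qed

section \<open>Invariant measures\<close>

lemma block_diagonal_mult_sum:
  assumes "block_diagonal A"
  shows "(A **\<^sub>s B) \<alpha> \<gamma> = (\<Sum>\<beta>\<in>mlevel (mdeg \<alpha>). A \<alpha> \<beta> * B \<beta> \<gamma>)"
  by (rule smat_mult_sum[OF finite_mlevel]) (use assms in \<open>auto simp: block_diagonal_iff mlevel_def\<close>)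

lemma mult_block_diagonal_sum:
  assumes "block_diagonal B"
  shows "(A **\<^sub>s B) \<alpha> \<gamma> = (\<Sum>\<beta>\<in>mlevel (mdeg \<gamma>). A \<alpha> \<beta> * B \<beta> \<gamma>)"
  by (rule smat_mult_sum[OF finite_mlevel]) (use assms in \<open>auto simp: block_diagonal_iff mlevel_def\<close>)

lemma block_diagonal_mult_vec_sum:
  assumes "block_diagonal A"
  shows "(A *v\<^sub>s v) \<alpha> = (\<Sum>\<beta>\<in>mlevel (mdeg \<alpha>). A \<alpha> \<beta> * v \<beta>)"
  by (rule smat_mult_vec_sum[OF finite_mlevel]) (use assms in \<open>auto simp: block_diagonal_iff mlevel_def\<close>)

lemma stranspose_moment_matrix: "stranspose (moment_matrix \<mu>) = moment_matrix \<mu>"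
  by (intro ext) (simp add: stranspose_def moment_matrix_def mult.commute)

lemma borel_measurable_chi: "(\<lambda>x. chi x \<alpha>) \<in> borel_measurable borel"
  unfolding chi_def by (intro borel_measurable_continuous_onI continuous_intros)

lemma moment_matrix_invariant:
  fixes \<mu> :: "(real ^ 'd::{finite,linorder}) measure"
  assumes borel: "sets \<mu> = sets borel"
    and moments: "finite_moments \<mu>"
    and invariant: "\<And>A. A \<in> sets borel \<Longrightarrow> emeasure \<mu> ((\<lambda>x. R *v x) -` A) = emeasure \<mu> A"
  shows "moment_matrix \<mu> = eta R **\<^sub>s moment_matrix \<mu> **\<^sub>s stranspose (eta R)"
proof (intro ext)
  fix \<alpha> \<beta> :: "'d mindex"
  let ?E = "eta R" and ?G = "moment_matrix \<mu>"
  note E = eta_block_diagonal[of R]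
  have space: "space \<mu> = UNIV" using sets_eq_imp_space_eq[OF borel] by simp
  have "(\<lambda>x. R *v x) \<in> borel_measurable borel"
    by (intro borel_measurable_continuous_onI matrix_vector_mult_linear_continuous_on)
  then have meas: "(\<lambda>x. R *v x) \<in> measurable \<mu> borel"
    using measurable_cong_sets[OF borel refl] by blast
  \<comment> \<open>The hypothesis on preimages says that the image measure under R is
    \<open>\<mu>\<close> itself, so moments can be computed by a change of variables.\<close>
  have distr: "distr \<mu> borel (\<lambda>x. R *v x) = \<mu>"
    by (rule measure_eqI) (simp_all add: borel emeasure_distr[OF meas] space invariant)
  have int: "integrable \<mu> (\<lambda>x. chi x \<gamma> * chi x \<delta>)" for \<gamma> \<delta>
    using moments by (simp add: chi_add finite_moments_def)
  have "?G \<alpha> \<beta> = (\<integral>x. chi x \<alpha> * chi x \<beta> \<partial>distr \<mu> borel (\<lambda>x. R *v x))"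
    by (simp add: distr moment_matrix_def)
  also have "\<dots> = (\<integral>x. chi (R *v x) \<alpha> * chi (R *v x) \<beta> \<partial>\<mu>)"
    by (rule integral_distr[OF meas]) (intro borel_measurable_times borel_measurable_chi)
  also have "\<dots> = (\<integral>x. (\<Sum>\<delta>\<in>mlevel (mdeg \<beta>). \<Sum>\<gamma>\<in>mlevel (mdeg \<alpha>).
      ?E \<alpha> \<gamma> * ?E \<beta> \<delta> * (chi x \<gamma> * chi x \<delta>)) \<partial>\<mu>)"
    unfolding chi_eta block_diagonal_mult_vec_sum[OF E] sum_product
    by (subst sum.swap) (simp add: ac_simps)
  also have "\<dots> = (\<Sum>\<delta>\<in>mlevel (mdeg \<beta>). \<Sum>\<gamma>\<in>mlevel (mdeg \<alpha>). ?E \<alpha> \<gamma> * ?E \<beta> \<delta> * ?G \<gamma> \<delta>)"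
    by (simp add: integral_sum int moment_matrix_def)
  also have "\<dots> = (?E **\<^sub>s ?G **\<^sub>s stranspose ?E) \<alpha> \<beta>"
    unfolding mult_block_diagonal_sum[OF block_diagonal_stranspose[OF E]] block_diagonal_mult_sum[OF E]
    by (simp add: stranspose_def sum_distrib_left sum_distrib_right ac_simps)
  finally show "?G \<alpha> \<beta> = (?E **\<^sub>s ?G **\<^sub>s stranspose ?E) \<alpha> \<beta>" .
qed

text \<open>On and above the block diagonal S agrees with the identity, and block diagonal factors
  preserve degrees. There E S F therefore agrees with E F.\<close>

lemma block_diagonal_conj_lower_unitriangular:
  assumes S: "block_lower_unitriangular S" and E: "block_diagonal E" and F: "block_diagonal F"
    and EF: "E **\<^sub>s F = sone_on UNIV"
  shows "block_lower_unitriangular (E **\<^sub>s S **\<^sub>s F)"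
  unfolding block_lower_unitriangular_iff
proof (intro allI impI)
  fix \<alpha> \<beta> :: "'a mindex" assume le: "mdeg \<alpha> \<le> mdeg \<beta>"
  have "(E **\<^sub>s S) \<alpha> \<gamma> = E \<alpha> \<gamma>" if \<gamma>: "\<gamma> \<in> mlevel (mdeg \<beta>)" for \<gamma>
  proof -
    have "(E **\<^sub>s S) \<alpha> \<gamma> = (\<Sum>\<delta>\<in>mlevel (mdeg \<alpha>). E \<alpha> \<delta> * (if \<delta> = \<gamma> then 1 else 0))"
      unfolding block_diagonal_mult_sum[OF E]
      by (rule sum.cong) (use S \<gamma> le in \<open>auto simp: block_lower_unitriangular_iff mlevel_def\<close>)
    also have "\<dots> = (E **\<^sub>s sone_on UNIV) \<alpha> \<gamma>"
      unfolding block_diagonal_mult_sum[OF E] by (simp add: sone_on_def)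
    finally show ?thesis by simp
  qed
  then have "(E **\<^sub>s S **\<^sub>s F) \<alpha> \<beta> = (E **\<^sub>s F) \<alpha> \<beta>"
    unfolding mult_block_diagonal_sum[OF F] by simp
  then show "(E **\<^sub>s S **\<^sub>s F) \<alpha> \<beta> = (if \<alpha> = \<beta> then 1 else 0)"
    by (simp add: EF sone_on_def)
qed

lemma monic_orthogonal_commute:
  assumes C: "trunc_inverse G C" and mo: "monic_orthogonal G S"
    and E: "block_diagonal E" and F: "block_diagonal F"
    and EF: "E **\<^sub>s F = sone_on UNIV" and FE: "F **\<^sub>s E = sone_on UNIV"
    and G: "G = E **\<^sub>s G **\<^sub>s stranspose E"
  shows "E **\<^sub>s S = S **\<^sub>s E"
proof -
  have S: "block_lower_unitriangular S" using mo by (simp add: monic_orthogonal_def)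
  note rfS = row_finite_block_lower_unitriangular[OF S]
  note rfE = row_finite_block_diagonal[OF E] and rfF = row_finite_block_diagonal[OF F]
  \<comment> \<open>Invariance in the form F G = G E^T turns (E S F) G into E (S G) E^T. The outer
    factors preserve degrees, so the zeros of S G below the block diagonal survive.\<close>
  have "F **\<^sub>s G = F **\<^sub>s (E **\<^sub>s G **\<^sub>s stranspose E)" using G by simp
  also have "\<dots> = F **\<^sub>s (E **\<^sub>s (G **\<^sub>s stranspose E))" by (simp add: smat_mult_assoc_rc rfE)
  also have "\<dots> = G **\<^sub>s stranspose E" by (simp add: FE flip: smat_mult_assoc_rr[OF rfF rfE])
  finally have FG: "F **\<^sub>s G = G **\<^sub>s stranspose E" .
  have "(E **\<^sub>s S **\<^sub>s F) **\<^sub>s G = (E **\<^sub>s S) **\<^sub>s (G **\<^sub>s stranspose E)"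
    by (simp add: smat_mult_assoc_rr row_finite_mult rfE rfS rfF FG)
  also have "\<dots> = E **\<^sub>s (S **\<^sub>s (G **\<^sub>s stranspose E))"
    by (rule smat_mult_assoc_rr[OF rfE rfS])
  also have "\<dots> = E **\<^sub>s (S **\<^sub>s G **\<^sub>s stranspose E)"
    by (simp add: smat_mult_assoc_rc rfS rfE)
  finally have eq: "(E **\<^sub>s S **\<^sub>s F) **\<^sub>s G = E **\<^sub>s (S **\<^sub>s G **\<^sub>s stranspose E)" .
  have "((E **\<^sub>s S **\<^sub>s F) **\<^sub>s G) \<alpha> \<gamma> = 0" if "mdeg \<gamma> < mdeg \<alpha>" for \<alpha> \<gamma>
    unfolding eq block_diagonal_mult_sum[OF E] mult_block_diagonal_sum[OF block_diagonal_stranspose[OF E]]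
    using mo that by (auto intro!: sum.neutral simp: monic_orthogonal_def mlevel_def)
  then have "monic_orthogonal G (E **\<^sub>s S **\<^sub>s F)"
    using block_diagonal_conj_lower_unitriangular[OF S E F EF] by (simp add: monic_orthogonal_def)
  from monic_orthogonal_unique[OF C this mo] have "E **\<^sub>s S **\<^sub>s F **\<^sub>s E = S **\<^sub>s E" by simp
  moreover have "E **\<^sub>s S **\<^sub>s F **\<^sub>s E = E **\<^sub>s S"
    by (simp add: smat_mult_assoc_rr[of "E **\<^sub>s S" F] row_finite_mult rfE rfS rfF FE)
  ultimately show ?thesis by simp
qed

section \<open>The matrices n \<cdot> \<Lambda> and the Jacobi matrices\<close>

definition dot_shift :: "real ^ 'd::finite \<Rightarrow> 'd smat" where
  "dot_shift n = (\<lambda>\<alpha> \<beta>. \<Sum>a\<in>UNIV. vec_nth n a * shift a \<alpha> \<beta>)"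

lemma dot_shift_outside:
  "\<beta> \<notin> range (\<lambda>a. \<alpha>(a := \<alpha> a + 1)) \<Longrightarrow> dot_shift n \<alpha> \<beta> = 0"
  by (auto simp: dot_shift_def shift_def intro!: sum.neutral)

lemma row_finite_dot_shift: "row_finite (dot_shift n)"
  unfolding row_finite_def
proof
  fix \<alpha> :: "'a mindex"
  show "finite {\<beta>. dot_shift n \<alpha> \<beta> \<noteq> 0}"
    by (rule finite_subset[of _ "range (\<lambda>a. \<alpha>(a := \<alpha> a + 1))"]) (use dot_shift_outside in \<open>blast, simp\<close>)
qed

lemma dot_shift_chi: "dot_shift n *v\<^sub>s chi x = (\<lambda>\<alpha>. (n \<bullet> x) * chi x \<alpha>)"
proof
  fix \<alpha> :: "'a mindex"
  let ?F = "range (\<lambda>a. \<alpha>(a := \<alpha> a + 1))"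
  have "(dot_shift n *v\<^sub>s chi x) \<alpha> = (\<Sum>\<beta>\<in>?F. dot_shift n \<alpha> \<beta> * chi x \<beta>)"
    by (rule smat_mult_vec_sum) (simp_all add: dot_shift_outside)
  also have "\<dots> = (\<Sum>a\<in>UNIV. vec_nth n a * (\<Sum>\<beta>\<in>?F. shift a \<alpha> \<beta> * chi x \<beta>))"
    unfolding dot_shift_def sum_distrib_left sum_distrib_right by (subst sum.swap) (simp add: mult.assoc)
  also have "\<dots> = (\<Sum>a\<in>UNIV. vec_nth n a * (shift a *v\<^sub>s chi x) \<alpha>)"
    by (intro sum.cong refl arg_cong2[of _ _ _ _ "(*)"] smat_mult_vec_sum[symmetric])
       (auto simp: shift_def)
  also have "\<dots> = (n \<bullet> x) * chi x \<alpha>"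
    by (simp add: chi_shift inner_vec_def sum_distrib_right mult.assoc)
  finally show "(dot_shift n *v\<^sub>s chi x) \<alpha> = (n \<bullet> x) * chi x \<alpha>" .
qed

text \<open>The sum over the coordinates may be moved inside the two infinite products because all
  of these products can be taken over common finite index sets.\<close>

lemma dot_jacobi_eq:
  assumes S: "block_lower_unitriangular (gb_S \<mu>)"
  shows "dot_jacobi \<mu> n = gb_S \<mu> **\<^sub>s dot_shift n **\<^sub>s sinv (gb_S \<mu>)"
proof (intro ext)
  fix \<alpha> \<beta> :: "'a mindex"
  let ?S = "gb_S \<mu>" and ?T = "sinv (gb_S \<mu>)"
  let ?F = "{\<gamma> :: 'a mindex. mdeg \<gamma> < Suc (mdeg \<alpha>)}"
  \<comment> \<open>Row \<alpha> of S stays in degrees at most |\<alpha>|, and a shift raises one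
    exponent by 1. So \<open>F'\<close> contains every column reached from row \<alpha>, for all
    directions at once.\<close>
  define F' where "F' = (\<Union>\<gamma>\<in>?F. range (\<lambda>a. \<gamma>(a := \<gamma> a + 1)))"
  have fin: "finite F'" unfolding F'_def by (intro finite_UN_I finite_mdeg_less finite_imageI finite)
  have out: "\<gamma> \<in> ?F \<Longrightarrow> \<delta> \<notin> F' \<Longrightarrow> shift a \<gamma> \<delta> = 0" for a \<gamma> \<delta>
    unfolding F'_def shift_def by auto
  have expand: "(?S **\<^sub>s L **\<^sub>s ?T) \<alpha> \<beta> = (\<Sum>\<delta>\<in>F'. (\<Sum>\<gamma>\<in>?F. ?S \<alpha> \<gamma> * L \<gamma> \<delta>) * ?T \<delta> \<beta>)"
    if L: "\<And>\<gamma> \<delta>. \<gamma> \<in> ?F \<Longrightarrow> \<delta> \<notin> F' \<Longrightarrow> L \<gamma> \<delta> = 0" for L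
  proof -
    have SL: "(?S **\<^sub>s L) \<alpha> \<delta> = (\<Sum>\<gamma>\<in>?F. ?S \<alpha> \<gamma> * L \<gamma> \<delta>)" for \<delta>
      by (rule lower_mult_sum[OF S]) simp
    show ?thesis
      unfolding SL[symmetric] by (rule smat_mult_sum[OF fin]) (auto simp: SL L intro!: sum.neutral)
  qed
  have shift: "(?S **\<^sub>s shift a **\<^sub>s ?T) \<alpha> \<beta>
      = (\<Sum>\<delta>\<in>F'. (\<Sum>\<gamma>\<in>?F. ?S \<alpha> \<gamma> * shift a \<gamma> \<delta>) * ?T \<delta> \<beta>)" for a
    by (rule expand) (rule out)
  have "dot_jacobi \<mu> n \<alpha> \<beta> = (\<Sum>a\<in>UNIV. \<Sum>\<delta>\<in>F'. \<Sum>\<gamma>\<in>?F. vec_nth n a * (?S \<alpha> \<gamma> * shift a \<gamma> \<delta> * ?T \<delta> \<beta>))"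
    by (simp add: dot_jacobi_def jacobi_def shift sum_distrib_left sum_distrib_right)
  also have "\<dots> = (\<Sum>\<delta>\<in>F'. \<Sum>\<gamma>\<in>?F. \<Sum>a\<in>UNIV. vec_nth n a * (?S \<alpha> \<gamma> * shift a \<gamma> \<delta> * ?T \<delta> \<beta>))"
    by (subst sum.swap) (intro sum.cong refl sum.swap)
  also have "\<dots> = (?S **\<^sub>s dot_shift n **\<^sub>s ?T) \<alpha> \<beta>"
  proof (subst expand)
    show "dot_shift n \<gamma> \<delta> = 0" if "\<gamma> \<in> ?F" "\<delta> \<notin> F'" for \<gamma> \<delta>
      unfolding dot_shift_def using out[OF that] by simp
  qed (simp add: dot_shift_def sum_distrib_left sum_distrib_right ac_simps)
  finally show "dot_jacobi \<mu> n \<alpha> \<beta> = (?S **\<^sub>s dot_shift n **\<^sub>s ?T) \<alpha> \<beta>" .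
qed

lemma eta_dot_shift:
  assumes "orthogonal_matrix R"
  shows "eta R **\<^sub>s dot_shift n = dot_shift (R *v n) **\<^sub>s eta R"
proof (rule smat_eq_if_chi_eq)
  note rf = row_finite_block_diagonal[OF eta_block_diagonal] row_finite_dot_shift
  show "row_finite (eta R **\<^sub>s dot_shift n)" "row_finite (dot_shift (R *v n) **\<^sub>s eta R)"
    by (intro row_finite_mult rf)+
  fix x
  have scale: "A *v\<^sub>s (\<lambda>\<alpha>. c * v \<alpha>) = (\<lambda>\<alpha>. c * (A *v\<^sub>s v) \<alpha>)" if "row_finite A" for A :: "'a smat" and c v
  proof
    fix \<alpha>
    have F: "finite {\<beta>. A \<alpha> \<beta> \<noteq> 0}" using that by (simp add: row_finite_def)
    show "(A *v\<^sub>s (\<lambda>\<alpha>. c * v \<alpha>)) \<alpha> = c * (A *v\<^sub>s v) \<alpha>"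
      by (subst (1 2) smat_mult_vec_sum[OF F]) (simp_all add: sum_distrib_left ac_simps)
  qed
  have "(eta R **\<^sub>s dot_shift n) *v\<^sub>s chi x = (\<lambda>\<alpha>. (n \<bullet> x) * chi (R *v x) \<alpha>)"
    by (simp add: smat_mult_vec_assoc rf dot_shift_chi scale chi_eta)
  moreover have "(dot_shift (R *v n) **\<^sub>s eta R) *v\<^sub>s chi x = (\<lambda>\<alpha>. ((R *v n) \<bullet> (R *v x)) * chi (R *v x) \<alpha>)"
    by (simp add: smat_mult_vec_assoc rf dot_shift_chi flip: chi_eta)
  \<comment> \<open>Orthogonality of R enters here: the scalar factors on the two sides are n
    \<cdot> x and (Rn) \<cdot> (Rx).\<close>
  moreover have "(R *v n) \<bullet> (R *v x) = n \<bullet> x"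
    using assms orthogonal_transformation_matrix[of "(*v) R"] by (simp add: orthogonal_transformation_def)
  ultimately show "(eta R **\<^sub>s dot_shift n) *v\<^sub>s chi x = (dot_shift (R *v n) **\<^sub>s eta R) *v\<^sub>s chi x"
    by simp
qed

section \<open>The inverse of H and the blocks in the Christoffel-Darboux kernel\<close>

lemma inverse_congruence:
  assumes E: "block_diagonal E" and F: "block_diagonal F" and H: "block_diagonal H" and K: "block_diagonal K"
    and FE: "F **\<^sub>s E = sone_on UNIV" and HK: "H **\<^sub>s K = sone_on UNIV" and KH: "K **\<^sub>s H = sone_on UNIV"
    and EHE: "E **\<^sub>s H **\<^sub>s stranspose E = H"
  shows "stranspose E **\<^sub>s K **\<^sub>s E = K"
proof -
  let ?Et = "stranspose E"
  have rf: "row_finite E" "row_finite F" "row_finite H" "row_finite K" "row_finite ?Et"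
    by (intro row_finite_block_diagonal block_diagonal_stranspose E F H K)+
  note assoc = smat_mult_assoc_rr row_finite_mult rf
  \<comment> \<open>The congruence for H is used as F H = H E^T. Then E^T K E = K (H E^T) K E = K F
    (H K) E = K F E = K.\<close>
  have "F **\<^sub>s H = (F **\<^sub>s E) **\<^sub>s (H **\<^sub>s ?Et)" by (subst EHE[symmetric]) (simp add: assoc)
  then have FH: "F **\<^sub>s H = H **\<^sub>s ?Et" by (simp add: FE)
  have "?Et **\<^sub>s K **\<^sub>s E = (K **\<^sub>s H) **\<^sub>s (?Et **\<^sub>s K **\<^sub>s E)" by (simp add: KH)
  also have "\<dots> = K **\<^sub>s ((H **\<^sub>s ?Et) **\<^sub>s (K **\<^sub>s E))" by (simp add: assoc)
  also have "\<dots> = K **\<^sub>s (F **\<^sub>s ((H **\<^sub>s K) **\<^sub>s E))" by (simp add: assoc flip: FH)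
  also have "\<dots> = K" by (simp add: HK FE)
  finally show ?thesis .
qed

text \<open>The kernel is defined by inverting each diagonal block of H separately. A diagonal block
  of a product of block diagonal matrices is the product of the blocks, so these inverses are the
  blocks of one matrix K.\<close>

lemma sinv_on_sblock:
  assumes H: "block_diagonal H" and K: "block_diagonal K"
    and HK: "H **\<^sub>s K = sone_on UNIV" and KH: "K **\<^sub>s H = sone_on UNIV"
  shows "sinv_on (mlevel k) (sblock k k H) = sblock k k K"
proof (rule sinv_on_eqI)
  have bd: "block_diagonal (sblock k k A)" for A :: "'a smat"
    by (auto simp: block_diagonal_iff sblock_def mlevel_def)
  show "row_finite (sblock k k H)" "row_finite (sblock k k K)"
    by (intro row_finite_block_diagonal bd)+
  have prod: "(sblock k k A **\<^sub>s sblock k k B) \<alpha> \<gamma> = sblock k k (A **\<^sub>s B) \<alpha> \<gamma>"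
    if "block_diagonal A" for A B :: "'a smat" and \<alpha> \<gamma>
  proof -
    have "(sblock k k A **\<^sub>s sblock k k B) \<alpha> \<gamma> = (\<Sum>\<beta>\<in>mlevel k. sblock k k A \<alpha> \<beta> * sblock k k B \<beta> \<gamma>)"
      by (rule smat_mult_sum[OF finite_mlevel]) (simp add: sblock_def)
    also have "\<dots> = sblock k k (A **\<^sub>s B) \<alpha> \<gamma>"
      by (auto simp: sblock_def block_diagonal_mult_sum[OF that] mlevel_def)
    finally show ?thesis .
  qed
  show "sblock k k H **\<^sub>s sblock k k K = sone_on (mlevel k)"
    by (intro ext) (simp only: prod[OF H] HK, simp add: sblock_def sone_on_def)
  show "sblock k k K **\<^sub>s sblock k k H = sone_on (mlevel k)"
    by (intro ext) (simp only: prod[OF K] KH, simp add: sblock_def sone_on_def)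
  show "\<alpha> \<in> mlevel k \<and> \<beta> \<in> mlevel k" if "sblock k k K \<alpha> \<beta> \<noteq> 0" for \<alpha> \<beta>
    using that unfolding sblock_def by (metis (full_types))
qed

theorem proposition6p3p2:
  fixes \<mu> :: "(real ^ 'd::{finite,linorder}) measure" and R :: "real ^ 'd::{finite,linorder} ^ 'd::{finite,linorder}"
  assumes borel: "sets \<mu> = sets borel"
    and moments: "finite_moments \<mu>"
    and dets: "\<And>l. Determinant.det (strunc l (moment_matrix \<mu>)) \<noteq> 0"
    and orth: "orthogonal_matrix R"
    and invariant: "\<And>A. A \<in> sets borel \<Longrightarrow> emeasure \<mu> ((\<lambda>x. R *v x) -` A) = emeasure \<mu> A"
  shows "(\<forall>x. orth_poly \<mu> (R *v x) = eta R *v\<^sub>s orth_poly \<mu> x)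
       \<and> (\<forall>n. dot_jacobi \<mu> (R *v n) = eta R **\<^sub>s dot_jacobi \<mu> n **\<^sub>s sinv (eta R))
       \<and> (\<forall>l x y. CD_kernel \<mu> l (R *v x) (R *v y) = CD_kernel \<mu> l x y)"
proof -
  define G where "G = moment_matrix \<mu>"
  define S where "S = gb_S \<mu>"
  define H where "H = gb_H \<mu>"
  define T where "T = sinv S"
  define E where "E = eta R"
  \<comment> \<open>This is the inverse of \<eta>, since the transpose of R is its inverse.\<close>
  define F where "F = eta (Finite_Cartesian_Product.transpose R)"
  have sym: "stranspose G = G" by (simp add: G_def stranspose_moment_matrix)
  obtain C where C: "trunc_inverse G C" using trunc_inverse_exists[OF dets] G_def by blast
  note gb = gb_SH[OF sym[unfolded G_def] C[unfolded G_def], folded G_def S_def H_def]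
  have S: "block_lower_unitriangular S" and H: "block_diagonal H"
    using gb(2) by (simp_all add: gauss_borel_def)
  note T = sinv_block_lower_unitriangular[OF S, folded T_def]
  have E: "block_diagonal E" and F: "block_diagonal F"
    by (simp_all add: E_def F_def eta_block_diagonal)
  have EF: "E **\<^sub>s F = sone_on UNIV" and FE: "F **\<^sub>s E = sone_on UNIV"
    unfolding E_def F_def using orth by (auto intro!: eta_inverse simp: orthogonal_matrix_def)
  have rf: "row_finite E" "row_finite F" "row_finite S" "row_finite T"
    by (auto intro: row_finite_block_diagonal row_finite_block_lower_unitriangular E F S T(1))
  have G: "G = E **\<^sub>s G **\<^sub>s stranspose E"
    unfolding G_def E_def by (rule moment_matrix_invariant[OF borel moments invariant])
  have ES: "E **\<^sub>s S = S **\<^sub>s E"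
    by (rule monic_orthogonal_commute[OF C gb(1) E F EF FE G])

  have P: "orth_poly \<mu> (R *v x) = E *v\<^sub>s orth_poly \<mu> x" for x
  proof -
    have "orth_poly \<mu> (R *v x) = S *v\<^sub>s (E *v\<^sub>s chi x)"
      by (simp add: orth_poly_def S_def E_def chi_eta)
    also have "\<dots> = E *v\<^sub>s (S *v\<^sub>s chi x)"
      by (simp add: ES rf flip: smat_mult_vec_assoc)
    finally show ?thesis by (simp add: orth_poly_def S_def)
  qed

  have J: "dot_jacobi \<mu> (R *v n) = E **\<^sub>s dot_jacobi \<mu> n **\<^sub>s sinv E" for n
  proof -
    note assoc = smat_mult_assoc_rr row_finite_mult rf row_finite_dot_shift
    have sinvE: "sinv E = F" by (rule sinv_eqI) (use rf EF FE in auto)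
    \<comment> \<open>The inverses of the commuting matrices E and S commute as well. The chain
      appends S T, inserts E F between its factors and then replaces S E by E S.\<close>
    have "T **\<^sub>s F = T **\<^sub>s F **\<^sub>s (S **\<^sub>s T)" by (simp add: T(2))
    also have "\<dots> = T **\<^sub>s F **\<^sub>s (S **\<^sub>s E) **\<^sub>s F **\<^sub>s T" by (simp add: assoc EF)
    also have "\<dots> = T **\<^sub>s (F **\<^sub>s E) **\<^sub>s S **\<^sub>s F **\<^sub>s T" by (simp add: assoc flip: ES)
    also have "\<dots> = (T **\<^sub>s S) **\<^sub>s F **\<^sub>s T" by (simp add: FE)
    also have "\<dots> = F **\<^sub>s T" by (simp add: T(3))
    finally have TF: "T **\<^sub>s F = F **\<^sub>s T" .
    \<comment> \<open>The outer factors E and F are moved inwards past S and T. There E (n \<cdot>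
      \<Lambda>) becomes (Rn \<cdot> \<Lambda>) E, and E F cancels.\<close>
    have "E **\<^sub>s dot_jacobi \<mu> n **\<^sub>s sinv E = (E **\<^sub>s S) **\<^sub>s (dot_shift n **\<^sub>s (T **\<^sub>s F))"
      using dot_jacobi_eq[OF S[unfolded S_def], of n, folded S_def, folded T_def] by (simp add: sinvE assoc)
    also have "\<dots> = S **\<^sub>s ((E **\<^sub>s dot_shift n) **\<^sub>s (F **\<^sub>s T))"
      by (simp only: ES TF) (simp add: assoc)
    also have "\<dots> = S **\<^sub>s (dot_shift (R *v n) **\<^sub>s ((E **\<^sub>s F) **\<^sub>s T))"
      using eta_dot_shift[OF orth, of n, folded E_def] by (simp add: assoc)
    also have "\<dots> = dot_jacobi \<mu> (R *v n)"
      using dot_jacobi_eq[OF S[unfolded S_def], of "R *v n", folded S_def, folded T_def] by (simp add: EF assoc)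
    finally show ?thesis by simp
  qed

  have K: "CD_kernel \<mu> l (R *v x) (R *v y) = CD_kernel \<mu> l x y" for l x y
  proof -
    obtain K where K: "block_diagonal K" "H **\<^sub>s K = sone_on UNIV" "K **\<^sub>s H = sone_on UNIV"
      using gauss_borel_H_inverse[OF sym C gb(2)] by blast
    note cf = col_finite_block_diagonal[OF E] rf(3)
    \<comment> \<open>Insert H = S G S^T and exchange E with S on the left and, by transposition, on
      the right. Then E G E^T appears in the middle and equals G.\<close>
    have "E **\<^sub>s H **\<^sub>s stranspose E = E **\<^sub>s (S **\<^sub>s G **\<^sub>s stranspose S) **\<^sub>s stranspose E"
      using gb(3) by simp
    also have "\<dots> = E **\<^sub>s (S **\<^sub>s G) **\<^sub>s (stranspose S **\<^sub>s stranspose E)"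
      using cf by (simp add: smat_mult_assoc_cc smat_mult_assoc_rc row_finite_mult stranspose_mult rf)
    also have "\<dots> = (S **\<^sub>s E) **\<^sub>s G **\<^sub>s (stranspose E **\<^sub>s stranspose S)"
      by (simp add: rf ES flip: smat_mult_assoc_rr stranspose_mult)
    also have "\<dots> = S **\<^sub>s (E **\<^sub>s G **\<^sub>s stranspose E) **\<^sub>s stranspose S"
      using cf by (simp add: smat_mult_assoc_cc smat_mult_assoc_rr smat_mult_assoc_rc row_finite_mult
          stranspose_mult rf)
    also have "\<dots> = H" using gb(3) G by simp
    finally have EKE: "stranspose E **\<^sub>s K **\<^sub>s E = K"
      by (rule inverse_congruence[OF E F H K(1) FE K(2,3)])
    have CD: "CD_kernel \<mu> l x y = (\<Sum>k<l. \<Sum>\<alpha>\<in>mlevel k. \<Sum>\<beta>\<in>mlevel k.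
        orth_poly \<mu> x \<alpha> * K \<alpha> \<beta> * orth_poly \<mu> y \<beta>)" for x y
      unfolding CD_kernel_def sinv_on_sblock[OF H K, unfolded H_def]
      by (intro sum.cong refl) (simp add: sblock_def)
    \<comment> \<open>The bilinear form given by a block of K is invariant under E, because E^T K E
      = K and E maps each degree to itself.\<close>
    have block: "(\<Sum>\<alpha>\<in>mlevel k. \<Sum>\<beta>\<in>mlevel k. (E *v\<^sub>s p) \<alpha> * K \<alpha> \<beta> * (E *v\<^sub>s q) \<beta>)
        = (\<Sum>\<alpha>\<in>mlevel k. \<Sum>\<beta>\<in>mlevel k. p \<alpha> * K \<alpha> \<beta> * q \<beta>)" for p q and k
    proof -
      let ?L = "mlevel k :: 'd mindex set"
      have lev: "mlevel (mdeg \<alpha>) = ?L" if "\<alpha> \<in> ?L" for \<alpha>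
        using that by (simp add: mlevel_def)
      have "(\<Sum>\<alpha>\<in>?L. \<Sum>\<beta>\<in>?L. p \<alpha> * K \<alpha> \<beta> * q \<beta>)
          = (\<Sum>\<alpha>'\<in>?L. \<Sum>\<beta>'\<in>?L. p \<alpha>' * (\<Sum>\<beta>\<in>?L. (\<Sum>\<alpha>\<in>?L. E \<alpha> \<alpha>' * K \<alpha> \<beta>) * E \<beta> \<beta>') * q \<beta>')"
      proof (intro sum.cong refl)
        fix \<alpha>' \<beta>' assume l: "\<alpha>' \<in> ?L" "\<beta>' \<in> ?L"
        have "K \<alpha>' \<beta>' = (stranspose E **\<^sub>s K **\<^sub>s E) \<alpha>' \<beta>'" by (simp add: EKE)
        also have "\<dots> = (\<Sum>\<beta>\<in>?L. (\<Sum>\<alpha>\<in>?L. E \<alpha> \<alpha>' * K \<alpha> \<beta>) * E \<beta> \<beta>')"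
          unfolding mult_block_diagonal_sum[OF E] block_diagonal_mult_sum[OF block_diagonal_stranspose[OF E]]
          by (simp add: lev l stranspose_def)
        finally show "p \<alpha>' * K \<alpha>' \<beta>' * q \<beta>'
            = p \<alpha>' * (\<Sum>\<beta>\<in>?L. (\<Sum>\<alpha>\<in>?L. E \<alpha> \<alpha>' * K \<alpha> \<beta>) * E \<beta> \<beta>') * q \<beta>'" by simp
      qed
      \<comment> \<open>It remains to bring the four finite sums from the order \<alpha>', \<beta>',
        \<beta>, \<alpha> into the order \<alpha>, \<beta>, \<alpha>', \<beta>', in which the two
        inner ones are E applied to p and to q.\<close>
      also have "\<dots> = (\<Sum>\<alpha>'\<in>?L. \<Sum>\<beta>'\<in>?L. \<Sum>\<beta>\<in>?L. \<Sum>\<alpha>\<in>?L. E \<alpha> \<alpha>' * p \<alpha>' * K \<alpha> \<beta> * (E \<beta> \<beta>' * q \<beta>'))"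
        by (simp add: sum_distrib_left sum_distrib_right ac_simps)
      also have "\<dots> = (\<Sum>\<alpha>'\<in>?L. \<Sum>\<beta>\<in>?L. \<Sum>\<alpha>\<in>?L. \<Sum>\<beta>'\<in>?L. E \<alpha> \<alpha>' * p \<alpha>' * K \<alpha> \<beta> * (E \<beta> \<beta>' * q \<beta>'))"
        by (rule sum.cong[OF refl], subst sum.swap, intro sum.cong refl sum.swap)
      also have "\<dots> = (\<Sum>\<beta>\<in>?L. \<Sum>\<alpha>\<in>?L. \<Sum>\<alpha>'\<in>?L. \<Sum>\<beta>'\<in>?L. E \<alpha> \<alpha>' * p \<alpha>' * K \<alpha> \<beta> * (E \<beta> \<beta>' * q \<beta>'))"
        by (subst sum.swap, intro sum.cong refl sum.swap)
      also have "\<dots> = (\<Sum>\<alpha>\<in>?L. \<Sum>\<beta>\<in>?L. \<Sum>\<alpha>'\<in>?L. \<Sum>\<beta>'\<in>?L. E \<alpha> \<alpha>' * p \<alpha>' * K \<alpha> \<beta> * (E \<beta> \<beta>' * q \<beta>'))"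
        by (rule sum.swap)
      also have "\<dots> = (\<Sum>\<alpha>\<in>?L. \<Sum>\<beta>\<in>?L. (E *v\<^sub>s p) \<alpha> * K \<alpha> \<beta> * (E *v\<^sub>s q) \<beta>)"
        by (intro sum.cong refl)
           (simp add: block_diagonal_mult_vec_sum[OF E] lev sum_distrib_left sum_distrib_right, rule sum.swap)
      finally show ?thesis by simp
    qed
    show ?thesis unfolding CD P block ..
  qed
  show ?thesis using P J K by (simp add: E_def)
qed

end
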